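(* Let $\mathfrak{g}$ be a (finite-dimensional) Lie algebra over a local field $\mathbb{K}$. Then $\mathfrak{g}$ is contractible (i.e. there exists a contractive Lie algebra automorphism $\alpha\colon\mathfrak{g}\to\mathfrak{g}$) if and only if $\mathfrak{g}$ admits an $\mathbb{N}$-gradation.
   Context: A local field is a totally disconnected, non-discrete, locally compact topological field. All Lie algebras are finite-dimensional. A Lie algebra automorphism $\alpha$ of $\mathfrak{g}$ is contractive if $\alpha^n(x)\to0$ as $n\to\infty$ for each $x\in\mathfrak{g}$ (in the canonical vector space topology). A positive gradation on $\mathfrak{g}$ is a direct sum decomposition $\mathfrak{g}=\bigoplus_{r>0}\mathfrak{g}_r$ into vector subspaces $\mathfrak{g}_r\subseteq\mathfrak{g}$ indexed by positive real numbers $r$, such that $\mathfrak{g}_r=\{0\}$ for all but finitely many $r$ and $[\mathfrak{g}_r,\mathfrak{g}_s]\subseteq\mathfrak{g}_{r+s}$ for all $r,s>0$. An $\mathbb{N}$-gradation is a positive gradation such that $\mathfrak{g}_r\neq\{0\}$ implies $r\in\mathbb{N}=\{1,2,\ldots\}$, so that $\mathfrak{g}=\bigoplus_{r\in\mathbb{N}}\mathfrak{g}_r$. *)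

theory Defs
  imports "HOL-Analysis.Analysis"
begin

section \<open>Local fields\<close>

class topological_field = field + topological_ab_group_add + topological_semigroup_mult +
  assumes tendsto_inverse_nhds: "a \<noteq> 0 \<Longrightarrow> (inverse \<longlongrightarrow> inverse a) (nhds a)"

text \<open>The Hausdorff property need not be assumed: points are closed in a totally disconnected
  space, and a topological group with closed points is Hausdorff.\<close>

class local_field = topological_field +
  assumes totally_disconnected: "connected S \<Longrightarrow> x \<in> S \<Longrightarrow> y \<in> S \<Longrightarrow> x = y"
    and non_discrete: "\<exists>S. \<not> open S"
    and locally_compact: "\<exists>U K. open U \<and> compact K \<and> x \<in> U \<and> U \<subseteq> K"

lemma locally_compact_space_euclidean_local_field:
  "locally_compact_space (euclidean :: 'a::local_field topology)"
  using locally_compact by (auto simp: locally_compact_space_def)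


section \<open>The canonical vector space topology\<close>

definition finite_dimensional :: "('k::field \<Rightarrow> 'v::ab_group_add \<Rightarrow> 'v) \<Rightarrow> bool" where
  "finite_dimensional smul \<longleftrightarrow> (\<exists>B. finite B \<and> module.span smul B = UNIV)"

definition is_basis :: "('k::field \<Rightarrow> 'v::ab_group_add \<Rightarrow> 'v) \<Rightarrow> 'v set \<Rightarrow> bool" where
  "is_basis smul B \<longleftrightarrow> \<not> module.dependent smul B \<and> module.span smul B = UNIV"

lemma ex_basis:
  assumes "vector_space smul"
  shows "\<exists>B. is_basis smul B"
proof -
  interpret vector_space smul by fact
  show ?thesis
    using independent_extend_basis[OF independent_empty] span_extend_basis[OF independent_empty]
    by (auto simp: is_basis_def)
qed

lemma finite_basis:
  assumes "vector_space smul" "finite_dimensional smul" "is_basis smul B"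
  shows "finite B"
proof -
  interpret vector_space smul by fact
  show ?thesis
    using assms(2,3) independent_span_bound[of _ B]
    unfolding finite_dimensional_def is_basis_def by auto
qed

definition coordinates ::
    "('k::field \<Rightarrow> 'v::ab_group_add \<Rightarrow> 'v) \<Rightarrow> 'v set \<Rightarrow> 'v \<Rightarrow> ('v \<Rightarrow> 'k)" where
  "coordinates smul B v = restrict (module.representation smul B v) B"

text \<open>The topology transported from the product topology on $K^B$ by the coordinate map of a
  basis $B$.\<close>

definition coordinate_topology ::
    "('k::local_field \<Rightarrow> 'v::ab_group_add \<Rightarrow> 'v) \<Rightarrow> 'v set \<Rightarrow> 'v topology" where
  "coordinate_topology smul B =
     pullback_topology UNIV (coordinates smul B)
       (product_topology (\<lambda>_. euclidean) B)"

text \<open>The choice of the basis is immaterial in finite dimension, see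
  \<open>canonical_topology_eq\<close> below.\<close>

definition canonical_topology ::
    "('k::local_field \<Rightarrow> 'v::ab_group_add \<Rightarrow> 'v) \<Rightarrow> 'v topology" where
  "canonical_topology smul =
     coordinate_topology smul (SOME B. is_basis smul B)"

lemma coordinate_topology_mono:
  fixes smul :: "'k::local_field \<Rightarrow> 'v::ab_group_add \<Rightarrow> 'v"
  assumes vs: "vector_space smul"
    and fd: "finite_dimensional smul"
    and B: "is_basis smul B" and C: "is_basis smul C"
    and U: "openin (coordinate_topology smul C) U"
  shows "openin (coordinate_topology smul B) U"
proof -
  interpret vector_space smul by fact
  have finB: "finite B" using finite_basis[OF vs fd B] .
  have iB: "independent B" "span B = UNIV" and iC: "independent C" "span C = UNIV"
    using B C by (auto simp: is_basis_def)
  define P where "P = product_topology (\<lambda>_::'v. euclidean :: 'k topology) B"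
  define h where "h = (\<lambda>f c. if c \<in> C then \<Sum>b\<in>B. f b * representation C b c else undefined)"
  have h1: "continuous_map P euclidean (\<lambda>f. h f c)" if "c \<in> C" for c
  proof -
    have "((\<lambda>f. \<Sum>b\<in>B. f b * representation C b c)
            \<longlongrightarrow> (\<Sum>b\<in>B. g b * representation C b c)) (atin P g)"
      if "g \<in> topspace P" for g
    proof (intro tendsto_sum tendsto_mult tendsto_const)
      fix b assume "b \<in> B"
      then have "continuous_map P euclidean (\<lambda>f. f b)"
        unfolding P_def by (rule continuous_map_product_projection)
      then show "((\<lambda>f. f b) \<longlongrightarrow> g b) (atin P g)"
        using that by (simp add: continuous_map_atin)
    qed
    then show ?thesis
      using that by (simp add: continuous_map_atin h_def)
  qed
  have hc: "continuous_map P (product_topology (\<lambda>_. euclidean) C) h"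
    unfolding continuous_map_componentwise
    using h1 by (auto simp: h_def extensional_def)
  have eq: "coordinates smul C v = h (coordinates smul B v)" for v
  proof
    fix c
    have "representation C v c = (\<Sum>b\<in>B. representation B v b * representation C b c)"
      if "c \<in> C"
    proof -
      interpret L: Vector_Spaces.linear smul "(*)" "\<lambda>v. representation C v c"
        by (rule linear_representation[OF iC])
      have "v = (\<Sum>b\<in>B. smul (representation B v b) b)"
        using sum_representation_eq[OF iB(1) _ finB, of v] iB(2) by auto
      then have "representation C v c =
          representation C (\<Sum>b\<in>B. smul (representation B v b) b) c" by simp
      then show ?thesis by (simp only: L.sum L.scale)
    qed
    then show "coordinates smul C v c = h (coordinates smul B v) c"
      by (auto simp: coordinates_def h_def intro!: sum.cong)
  qed
  obtain W where W: "openin (product_topology (\<lambda>_. euclidean) C) W" "U = coordinates smul C -` W"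
    using U by (auto simp: coordinate_topology_def openin_pullback_topology)
  have "openin P {f \<in> topspace P. h f \<in> W}"
    using hc W(1) by (rule openin_continuous_map_preimage)
  moreover have "U = coordinates smul B -` {f \<in> topspace P. h f \<in> W}"
  proof -
    have "coordinates smul B v \<in> topspace P" for v
      by (auto simp: P_def coordinates_def)
    then show ?thesis
      using W(2) by (auto simp: eq)
  qed
  ultimately show ?thesis
    unfolding coordinate_topology_def openin_pullback_topology P_def by auto
qed

lemma canonical_topology_eq:
  assumes "vector_space smul" "finite_dimensional smul"
    "is_basis smul B"
  shows "canonical_topology smul = coordinate_topology smul B"
proof -
  have "is_basis smul (SOME B. is_basis smul B)"
    using ex_basis[OF assms(1)] by (rule someI_ex)
  then show ?thesis
    unfolding canonical_topology_def topology_eq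
    using coordinate_topology_mono[OF assms(1,2)] assms(3) by blast
qed


section \<open>Lie algebras, contractive automorphisms and gradations\<close>

locale lie_algebra = vector_space smul
  for smul :: "'k::field \<Rightarrow> 'g::ab_group_add \<Rightarrow> 'g" +
  fixes bracket :: "'g \<Rightarrow> 'g \<Rightarrow> 'g"
  assumes linear_bracket_left: "Vector_Spaces.linear smul smul (\<lambda>x. bracket x y)"
    and linear_bracket_right: "Vector_Spaces.linear smul smul (\<lambda>y. bracket x y)"
    and bracket_self: "bracket x x = 0"
    and jacobi: "bracket x (bracket y z) + bracket y (bracket z x) + bracket z (bracket x y) = 0"
begin

definition automorphism :: "('g \<Rightarrow> 'g) \<Rightarrow> bool" where
  "automorphism \<alpha> \<longleftrightarrow> Vector_Spaces.linear smul smul \<alpha> \<and> bij \<alpha> \<and>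
     (\<forall>x y. \<alpha> (bracket x y) = bracket (\<alpha> x) (\<alpha> y))"

text \<open>The components of \<open>x\<close> form a total function \<open>f\<close>; requiring \<open>f i = 0\<close> outside the index set
  makes \<open>\<exists>!f\<close> express uniqueness of the components with index in \<open>I\<close>.\<close>

definition direct_sum_decomposition :: "'i set \<Rightarrow> ('i \<Rightarrow> 'g set) \<Rightarrow> bool" where
  "direct_sum_decomposition I G \<longleftrightarrow>
     (\<forall>i\<in>I. subspace (G i)) \<and>
     (\<forall>x. \<exists>!f. (\<forall>i\<in>I. f i \<in> G i) \<and> (\<forall>i. i \<notin> I \<longrightarrow> f i = 0) \<and>
        finite {i. f i \<noteq> 0} \<and> x = (\<Sum>i | f i \<noteq> 0. f i))"

text \<open>Only the values \<open>G r\<close> with \<open>r > 0\<close> are relevant.\<close>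

definition positive_gradation :: "(real \<Rightarrow> 'g set) \<Rightarrow> bool" where
  "positive_gradation G \<longleftrightarrow>
     direct_sum_decomposition {0<..} G \<and>
     finite {r. r > 0 \<and> G r \<noteq> {0}} \<and>
     (\<forall>r>0. \<forall>s>0. \<forall>x\<in>G r. \<forall>y\<in>G s. bracket x y \<in> G (r + s))"

definition nat_gradation :: "(real \<Rightarrow> 'g set) \<Rightarrow> bool" where
  "nat_gradation G \<longleftrightarrow> positive_gradation G \<and> (\<forall>r>0. G r \<noteq> {0} \<longrightarrow> r \<in> \<nat>)"

end

locale finite_dimensional_lie_algebra = lie_algebra smul bracket
  for smul :: "'k::field \<Rightarrow> 'g::ab_group_add \<Rightarrow> 'g" and bracket +
  assumes finite_dimensional: "finite_dimensional smul"

definition contractive ::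
    "('k::local_field \<Rightarrow> 'v::ab_group_add \<Rightarrow> 'v) \<Rightarrow> ('v \<Rightarrow> 'v) \<Rightarrow> bool" where
  "contractive smul \<alpha> \<longleftrightarrow>
     (\<forall>x. limitin (canonical_topology smul) (\<lambda>n. (\<alpha> ^^ n) x) 0 sequentially)"

definition contractible_lie_algebra ::
    "('k::local_field \<Rightarrow> 'g::ab_group_add \<Rightarrow> 'g) \<Rightarrow> ('g \<Rightarrow> 'g \<Rightarrow> 'g) \<Rightarrow> bool" where
  "contractible_lie_algebra smul bracket \<longleftrightarrow>
     (\<exists>\<alpha>. lie_algebra.automorphism smul bracket \<alpha> \<and> contractive smul \<alpha>)"

end

theory Submission
  imports Defs
begin

text \<open>A contractive automorphism \<open>\<alpha>\<close> of a Lie algebra \<open>V\<close> is analysed through growth rates of its orbits. Fix a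
compact open subring \<open>R\<close> of the ground field and a nonzero \<open>p \<in> R\<close> whose powers shrink \<open>R\<close> to
\<open>0\<close> (lemma \<open>ex_contracting_scale\<close>). They replace a valuation ring and a uniformizer; neither an
absolute value on the field nor its extension to an algebraic closure is needed. In a basis of
\<open>V\<close>, the lattices \<open>p\<^sup>k R\<^sup>d\<close> measure the size of vectors, and \<open>V\<^sub>r\<close> is defined as the
set of those \<open>x\<close> for which \<open>\<alpha>\<^sup>n x\<close>, for \<open>n\<close> tending to plus and to minus infinity, lies in the
lattices of index about \<open>r n\<close>, up to an error \<open>\<epsilon> \<bar>n\<bar> + O(1)\<close> for each \<open>\<epsilon> > 0\<close>. Since the
bracket is bilinear, hence bounded, \<open>[V\<^sub>r, V\<^sub>s] \<subseteq> V\<^sub>r\<^sub>+\<^sub>s\<close> is immediate.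

That \<open>V\<close> is the direct sum of the \<open>V\<^sub>r\<close> rests on one statement about an arbitrary linear
automorphism \<open>f\<close> of \<open>V\<close>: each vector is the sum of one with bounded forward orbit and one
with bounded backward orbit (\<open>bounded_decomposition\<close>). It is proved by a compactness argument,
in the style of Willis' tidy subgroups, with the sets
\<open>L\<^sub>n = L \<inter> f L \<inter> \<dots> \<inter> f\<^sup>n L\<close> for a lattice \<open>L\<close>. Applied to \<open>p\<^sup>-\<^sup>m \<alpha>\<^sup>e\<close> it splits \<open>V\<close> at each
rational rate \<open>m/e\<close>, and, dimensions being finite, at each real rate. Bisection of a real interval
then yields finitely many rates \<open>r\<close> with \<open>V = \<Sum> V\<^sub>r\<close> (\<open>slope_span\<close>), all of them positive when
\<open>\<alpha>\<close> is contractive. Independence of the \<open>V\<^sub>r\<close> holds because no nonzero vector can have forward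
rate \<open>s\<close> and backward rate \<open>t\<close> with \<open>s + t > 0\<close> (\<open>decay_Int_trivial\<close>).

The rates \<open>r\<close> are replaced by natural numbers with Dirichlet's simultaneous approximation theorem:
if \<open>q r\<close> is close enough to an integer for each of the finitely many rates, then rounding \<open>q r\<close> is
injective on them and preserves all relations \<open>r + s = t\<close> (\<open>ex_additive_rounding\<close>).

Conversely, for an \<open>\<nat>\<close>-gradation, multiplication by \<open>p\<^sup>r\<close> on the component of degree \<open>r\<close> is a
contractive automorphism.\<close>

section \<open>Compact open subrings of local fields\<close>

lemma closed_singleton_local_field: "closed {x::'a::local_field}"
proof -
  have "connected (closure {x})"
    by (intro connected_imp_connected_closure) simp
  then have "closure {x} \<subseteq> {x}"
    using totally_disconnected[of "closure {x}"] closure_subset[of "{x}"] by blast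
  then show ?thesis by (metis closed_closure closure_subset subset_antisym)
qed

lemma Hausdorff_space_local_field: "Hausdorff_space (euclidean :: 'a::local_field topology)"
  unfolding Hausdorff_space_def
proof (intro allI impI)
  fix x y :: 'a assume "x \<in> topspace euclidean \<and> y \<in> topspace euclidean \<and> x \<noteq> y"
  then have ne: "x - y \<in> - {0}" by simp
  have "open (- {0::'a})" by (intro open_Compl closed_singleton_local_field)
  moreover have "continuous_on UNIV (\<lambda>p::'a \<times> 'a. fst p - snd p)"
    by (intro continuous_intros)
  ultimately have "open ((\<lambda>p::'a \<times> 'a. fst p - snd p) -` (- {0}))"
    by (rule open_vimage)
  moreover have "(x, y) \<in> (\<lambda>p::'a \<times> 'a. fst p - snd p) -` (- {0})" using ne by simp
  ultimately obtain A B where "open A" "open B" "x \<in> A" "y \<in> B"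
    "A \<times> B \<subseteq> (\<lambda>p::'a \<times> 'a. fst p - snd p) -` (- {0})"
    by (rule open_prod_elim) blast
  then show "\<exists>U V. openin euclidean U \<and> openin euclidean V \<and> x \<in> U \<and> y \<in> V \<and> disjnt U V"
    unfolding disjnt_iff open_openin[symmetric] by fastforce
qed

lemma compact_imp_closed_local_field:
  fixes S :: "'a::local_field set"
  assumes "compact S" shows "closed S"
  using compactin_imp_closedin[OF Hausdorff_space_local_field] assms by simp

text \<open>A compact neighbourhood \<open>K\<close> of \<open>0\<close> is a totally disconnected compact Hausdorff space. Its
connected components, being points, agree with its quasi-components, so a clopen subset of \<open>K\<close>
contains \<open>0\<close> and lies in a given open neighbourhood \<open>U \<subseteq> K\<close>. It is then open in the whole field.\<close>

lemma ex_compact_open_neighbourhood: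
  "\<exists>C :: 'a::local_field set. compact C \<and> open C \<and> 0 \<in> C"
proof -
  obtain U K :: "'a set" where UK: "open U" "compact K" "0 \<in> U" "U \<subseteq> K"
    using locally_compact[of 0] by blast
  define X where "X = subtopology euclidean K"
  have ts: "topspace X = K" by (simp add: X_def)
  have cX: "compact_space X" unfolding X_def
    using UK(2) by (simp add: compact_space_subtopology)
  have hX: "Hausdorff_space X" unfolding X_def
    by (simp add: Hausdorff_space_local_field Hausdorff_space_subtopology)
  have clK: "closed K" using UK(2) by (rule compact_imp_closed_local_field)
  have "separated_between X {0} (K - U)"
  proof (rule cut_wire_fence_theorem[OF cX hX])
    show "closedin X {0}" 
      unfolding X_def using UK by (auto simp: closedin_closed intro!: exI[of _ "{0}"] closed_singleton_local_field)
    show "closedin X (K - U)"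
      unfolding X_def using UK by (auto simp: closedin_closed intro!: exI[of _ "- U"])
    fix C assume "connectedin X C"
    then have "connected C" by (simp add: X_def connectedin_subtopology)
    then show "disjnt C {0} \<or> disjnt C (K - U)"
      using totally_disconnected[of C 0] UK(3) by (auto simp: disjnt_iff)
  qed
  then obtain A B where AB: "openin X A" "openin X B" "A \<union> B = K" "disjnt A B" "0 \<in> A" "K - U \<subseteq> B"
    unfolding separated_between_def ts by auto
  have AU: "A \<subseteq> U" using AB by (auto simp: disjnt_iff)
  obtain W where W: "open W" "A = W \<inter> K"
    using AB(1) unfolding X_def by (auto simp: openin_open)
  have "A = W \<inter> U" using AU W(2) UK(4) by blast
  then have "open A" using W(1) UK(1) by auto
  moreover have "compact A"
  proof -
    have "A = topspace X - B" using AB ts by (auto simp: disjnt_iff)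
    then have "closedin X A" using AB(2) by auto
    then have "closed A" using clK unfolding X_def by (metis closedin_closed_trans)
    then have "compact (K \<inter> A)" using UK(2) by (rule compact_Int_closed[rotated])
    then show ?thesis using W(2) by (simp add: inf.absorb2)
  qed
  ultimately show ?thesis using AB(5) by blast
qed

lemma tube_neighbourhood:
  assumes "compact C" "continuous_on UNIV f" "open U" "\<And>c. c \<in> C \<Longrightarrow> f (a, c) \<in> U"
  obtains A where "open A" "a \<in> A" "\<And>x c. x \<in> A \<Longrightarrow> c \<in> C \<Longrightarrow> f (x, c) \<in> U"
proof -
  have o: "open (f -` U)" using assms(3,2) by (rule open_vimage)
  have "{a} \<times> C \<subseteq> f -` U" using assms(4) by auto
  from Elementary_Topology.tube_lemma[OF assms(1) o this]
  obtain A where "a \<in> A" "open A" "A \<times> C \<subseteq> f -` U" by blast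
  then show ?thesis using that[of A] by blast
qed

lemma continuous_on_times_local_field:
  "continuous_on UNIV (\<lambda>p. fst p * snd p :: 'a::local_field)"
  by (intro continuous_intros)

lemma open_translation: 
  fixes S :: "'a::local_field set"
  assumes "open S" shows "open {x. x - a \<in> S}"
proof -
  have "open ((\<lambda>x. x - a) -` S)" by (intro open_vimage assms continuous_intros)
  then show ?thesis by (simp add: vimage_def)
qed

lemma open_scaling: 
  fixes S :: "'a::local_field set"
  assumes "open S" shows "open {x. a * x \<in> S}"
proof -
  have "open ((\<lambda>x. a * x) -` S)" by (intro open_vimage assms continuous_intros)
  then show ?thesis by (simp add: vimage_def)
qed

text \<open>Subgroups of the additive group.\<close>

definition additive_subgroup :: "'a::ab_group_add set \<Rightarrow> bool" where
  "additive_subgroup S \<longleftrightarrow> 0 \<in> S \<and> (\<forall>x\<in>S. \<forall>y\<in>S. x - y \<in> S)"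

lemma additive_subgroupD:
  assumes "additive_subgroup S"
  shows "0 \<in> S" "x \<in> S \<Longrightarrow> y \<in> S \<Longrightarrow> x - y \<in> S" "x \<in> S \<Longrightarrow> - x \<in> S"
    "x \<in> S \<Longrightarrow> y \<in> S \<Longrightarrow> x + y \<in> S"
proof -
  have 1: "x - y \<in> S" if "x \<in> S" "y \<in> S" for x y
    using assms that by (auto simp: additive_subgroup_def)
  have 0: "0 \<in> S" using assms by (auto simp: additive_subgroup_def)
  have 2: "- x \<in> S" if "x \<in> S" for x using 1[OF 0 that] by simp
  show "0 \<in> S" by fact
  show "x \<in> S \<Longrightarrow> y \<in> S \<Longrightarrow> x - y \<in> S" by (rule 1)
  show "x \<in> S \<Longrightarrow> - x \<in> S" by (rule 2)
  show "x + y \<in> S" if "x \<in> S" "y \<in> S"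
    using 1[OF that(1) 2[OF that(2)]] by simp
qed

lemma open_subgroup:
  fixes S :: "'a::local_field set"
  assumes "additive_subgroup S" "open A" "0 \<in> A" "A \<subseteq> S"
  shows "open S"
proof -
  have "\<exists>T. open T \<and> x \<in> T \<and> T \<subseteq> S" if "x \<in> S" for x
  proof (intro exI conjI)
    show "open {y. y - x \<in> A}" using assms(2) by (rule open_translation)
    show "{y. y - x \<in> A} \<subseteq> S"
      using additive_subgroupD(4)[OF assms(1) _ that] assms(4) by force
  qed (use assms in auto)
  then show ?thesis by (subst open_subopen) blast
qed

lemma closed_open_subgroup:
  fixes S :: "'a::local_field set"
  assumes "additive_subgroup S" "open S"
  shows "closed S"
proof -
  have "\<exists>T. open T \<and> x \<in> T \<and> T \<subseteq> - S" if "x \<in> - S" for x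
  proof (intro exI conjI)
    show "open {y. y - x \<in> S}" using assms(2) by (rule open_translation)
    show "{y. y - x \<in> S} \<subseteq> - S"
    proof safe
      fix y assume "y - x \<in> S" "y \<in> S"
      then have "y - (y - x) \<in> S" using additive_subgroupD(2)[OF assms(1)] by blast
      then have "x \<in> S" by (simp add: algebra_simps)
      then show False using that by simp
    qed
  qed (use additive_subgroupD(1)[OF assms(1)] in auto)
  then have "open (- S)" by (subst open_subopen) blast
  then show ?thesis by (simp add: closed_def)
qed

text \<open>Van Dantzig's theorem for the additive group of a local field: the stabilizer of a compact open
neighbourhood of \<open>0\<close> under translations.\<close>

lemma ex_compact_open_subgroup:
  "\<exists>S :: 'a::local_field set. compact S \<and> open S \<and> additive_subgroup S"
proof -
  obtain C :: "'a set" where C: "compact C" "open C" "0 \<in> C"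
    using ex_compact_open_neighbourhood by blast
  define T where "T = {x. \<forall>c\<in>C. x + c \<in> C}"
  define S where "S = {x. x \<in> T \<and> - x \<in> T}"
  have cont: "continuous_on UNIV (\<lambda>p::'a\<times>'a. fst p + snd p)" by (intro continuous_intros)
  obtain A where A: "open A" "0 \<in> A" "\<And>x c. x \<in> A \<Longrightarrow> c \<in> C \<Longrightarrow> x + c \<in> C"
    by (rule tube_neighbourhood[OF C(1) cont C(2), of 0]) auto
  have oA: "open (uminus -` A)" by (intro open_vimage A continuous_intros)
  have T_add: "x + y \<in> T" if "x \<in> T" "y \<in> T" for x y
    using that by (simp add: T_def add.assoc)
  have "0 \<in> T" by (simp add: T_def)
  then have sub: "additive_subgroup S"
    unfolding additive_subgroup_def S_def using T_add[of _ "- _"] T_add[of "- _" _]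
    by (auto simp: add.commute)
  have "A \<subseteq> T" using A(3) by (auto simp: T_def)
  then have "A \<inter> uminus -` A \<subseteq> S" by (auto simp: S_def)
  then have "open S" using A(1,2) oA by (intro open_subgroup[OF sub, of "A \<inter> uminus -` A"]) auto
  moreover have "x \<in> C" if "x \<in> T" for x
    using that C(3) unfolding T_def by (metis (mono_tags, lifting) add_0_right mem_Collect_eq)
  then have "S \<subseteq> C" by (auto simp: S_def)
  then have "compact S"
    using C(1) closed_open_subgroup[OF sub \<open>open S\<close>] by (metis compact_Int_closed inf.absorb2)
  ultimately show ?thesis using sub by blast
qed

lemma ex_nonzero_in_open:
  fixes A :: "'a::local_field set"
  assumes "open A" "0 \<in> A"
  obtains a where "a \<in> A" "a \<noteq> 0"
proof -
  have False if "A \<subseteq> {0}"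
  proof -
    have "A = {0}" using that assms by auto
    then have *: "open {x::'a. x - a \<in> {0}}" for a using open_translation[OF assms(1)] by metis
    have "open {a}" for a :: 'a using *[of a] by simp
    then have "open S" for S :: "'a set" by (subst open_subopen) blast
    then show False using non_discrete by blast
  qed
  then show ?thesis using that by blast
qed

text \<open>The ring of multipliers of a compact open subgroup \<open>S\<close>. It is contained in \<open>s\<^sup>-\<^sup>1 S\<close> for each
nonzero \<open>s \<in> S\<close>, hence compact.\<close>

lemma ex_compact_open_subring:
  "\<exists>R :: 'a::local_field set. compact R \<and> open R \<and> additive_subgroup R \<and> 1 \<in> R \<and>
     (\<forall>x\<in>R. \<forall>y\<in>R. x * y \<in> R)"
proof -
  obtain S :: "'a set" where S: "compact S" "open S" "additive_subgroup S"
    using ex_compact_open_subgroup by blast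
  note SD = additive_subgroupD[OF S(3)]
  define R where "R = {x. \<forall>s\<in>S. x * s \<in> S}"
  have R: "additive_subgroup R"
    using SD by (auto simp: additive_subgroup_def R_def left_diff_distrib)
  obtain A where A: "open A" "0 \<in> A" "\<And>x c. x \<in> A \<Longrightarrow> c \<in> S \<Longrightarrow> x * c \<in> S"
    by (rule tube_neighbourhood[OF S(1) continuous_on_times_local_field S(2), of 0])
      (use SD in auto)
  have oR: "open R" by (rule open_subgroup[OF R A(1,2)]) (use A(3) in \<open>auto simp: R_def\<close>)
  obtain s where s: "s \<in> S" "s \<noteq> 0" using ex_nonzero_in_open[OF S(2) SD(1)] by blast
  have "compact ((\<lambda>x. inverse s * x) ` S)"
    by (intro compact_continuous_image S continuous_intros)
  moreover have "R \<subseteq> (\<lambda>x. inverse s * x) ` S"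
  proof
    fix x assume "x \<in> R"
    then have "x * s \<in> S" using s by (auto simp: R_def)
    then show "x \<in> (\<lambda>x. inverse s * x) ` S" using s(2)
      by (intro image_eqI[of _ _ "x * s"]) (auto simp: field_simps)
  qed
  ultimately have "compact R"
    using closed_open_subgroup[OF R oR] by (metis compact_Int_closed inf.absorb2)
  moreover have "1 \<in> R" by (simp add: R_def)
  moreover have "x * y \<in> R" if "x \<in> R" "y \<in> R" for x y 
    using that unfolding R_def by (simp add: mult.assoc)
  ultimately show ?thesis using R oR by blast
qed

section \<open>Contracting scales\<close>

text \<open>A compact open subring \<open>R\<close> together with a nonzero element \<open>p\<close> of \<open>R\<close> such that the sets
\<open>p\<^sup>n R\<close> form a neighbourhood basis of \<open>0\<close>. The ring \<open>R\<close> need not be the full valuation ring, and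
\<open>p\<close> need not generate its maximal ideal.\<close>

locale contracting_scale =
  fixes R :: "'k::local_field set" and p :: 'k
  assumes subgroup_R: "additive_subgroup R"
    and compact_R: "compact R" and open_R: "open R"
    and one_R: "1 \<in> R" and mult_R: "x \<in> R \<Longrightarrow> y \<in> R \<Longrightarrow> x * y \<in> R"
    and p_R: "p \<in> R" and p_nonzero: "p \<noteq> 0"
    and contracting: "open U \<Longrightarrow> 0 \<in> U \<Longrightarrow> \<exists>n. \<forall>x\<in>R. p ^ n * x \<in> U"

text \<open>Any nonzero nonunit \<open>a\<close> of a compact open subring \<open>R\<close> serves as \<open>p\<close>. If the intersection \<open>I\<close> of
the ideals \<open>a\<^sup>n R\<close> were nonzero, it would be an open ideal, hence of finite index, and two powers of
\<open>a\<close> would be congruent modulo \<open>I\<close>. As \<open>I = a I\<close>, this makes \<open>a\<close> a unit. So \<open>I = 0\<close>, and by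
compactness the sets \<open>a\<^sup>n R\<close> become arbitrarily small.\<close>

lemma ex_contracting_scale:
  "\<exists>(R :: 'k::local_field set) p. contracting_scale R p"
proof -
  obtain R :: "'k set" where R: "compact R" "open R" "additive_subgroup R" "1 \<in> R"
    and mult_R: "\<And>x y. x \<in> R \<Longrightarrow> y \<in> R \<Longrightarrow> x * y \<in> R"
    using ex_compact_open_subring by blast
  note RD = additive_subgroupD[OF R(3)]
  have power_R: "x ^ n \<in> R" if "x \<in> R" for x n
    using that by (induction n) (auto intro: R(4) mult_R)
  have "open (- {1::'k})" by (intro open_Compl closed_singleton_local_field)
  \<comment> \<open>Elements close to \<open>0\<close> are not invertible in the compact ring \<open>R\<close>, as \<open>0 * c \<noteq> 1\<close> for \<open>c \<in> R\<close>.\<close>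
  then obtain A where A: "open A" "0 \<in> A" "\<And>x c. x \<in> A \<Longrightarrow> c \<in> R \<Longrightarrow> x * c \<noteq> 1"
    using tube_neighbourhood[OF R(1) continuous_on_times_local_field, of "- {1}" 0] by auto
  have "open (A \<inter> R)" "0 \<in> A \<inter> R" using A R(2) RD(1) by auto
  then obtain a where a: "a \<in> A \<inter> R" "a \<noteq> 0" by (rule ex_nonzero_in_open)
  have nonunit: "inverse a \<notin> R" using A(3)[of a "inverse a"] a by auto
  define I where "I = {x. \<forall>n. inverse a ^ n * x \<in> R}"
  have I_div: "inverse a ^ m * x \<in> I" if "x \<in> I" for x m
    unfolding I_def
  proof safe
    fix n
    have "inverse a ^ (n + m) * x \<in> R" using that unfolding I_def by blast
    then show "inverse a ^ n * (inverse a ^ m * x) \<in> R"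
      by (simp add: power_add mult.assoc)
  qed
  have I_sub: "additive_subgroup I"
    using RD by (auto simp: additive_subgroup_def I_def right_diff_distrib)
  have I0: "z = 0" if z: "z \<in> I" for z
  proof (rule ccontr)
    assume nz: "z \<noteq> 0"
    have "{x. inverse z * x \<in> R} \<subseteq> I"
    proof safe
      fix x assume x: "inverse z * x \<in> R"
      have "inverse a ^ n * x \<in> R" for n
      proof -
        have "(inverse a ^ n * z) * (inverse z * x) \<in> R"
          by (rule mult_R) (use z x in \<open>auto simp: I_def\<close>)
        then show ?thesis using nz by (simp add: field_simps)
      qed
      then show "x \<in> I" by (simp add: I_def)
    qed
    then have oI: "open I"
      using open_scaling[OF R(2), of "inverse z"] RD(1)
      by (intro open_subgroup[OF I_sub]) auto
    obtain F where F: "finite F" "R \<subseteq> (\<Union>x\<in>F. {y. y - x \<in> I})"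
    proof (rule compactE_image[OF R(1), of R "\<lambda>x. {y. y - x \<in> I}"])
      show "open {y. y - x \<in> I}" for x using oI by (rule open_translation)
      show "R \<subseteq> (\<Union>x\<in>R. {y. y - x \<in> I})"
        using additive_subgroupD(1)[OF I_sub] by auto
    qed
    have "\<forall>n. \<exists>x\<in>F. a ^ n - x \<in> I" using F(2) power_R a by blast
    then obtain g where g: "\<And>n. g n \<in> F" "\<And>n. a ^ n - g n \<in> I" by metis
    have "\<not> inj g" using g(1) F(1) by (meson finite_imageD finite_subset image_subsetI infinite_UNIV_nat)
    then obtain m n where mn: "m < n" "g m = g n" by (metis injI linorder_neqE_nat)
    have "(a ^ m - g m) - (a ^ n - g n) \<in> I"
      by (rule additive_subgroupD(2)[OF I_sub g(2) g(2)])
    then have "inverse a ^ m * (a ^ m - a ^ n) \<in> I" using mn(2) I_div by simp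
    moreover have "inverse a ^ m * (a ^ m - a ^ n) = 1 - a ^ (n - m)"
      using a mn(1) by (simp add: right_diff_distrib power_diff field_simps)
    ultimately have "1 - a ^ (n - m) \<in> I" by simp
    then have "inverse a ^ 1 * (1 - a ^ (n - m)) \<in> R" unfolding I_def by blast
    moreover have "inverse a ^ 1 * (1 - a ^ (n - m)) = inverse a - a ^ (n - m - 1)"
      using a mn(1) by (simp add: right_diff_distrib power_diff field_simps)
    ultimately have "(inverse a - a ^ (n - m - 1)) + a ^ (n - m - 1) \<in> R"
      using power_R a by (intro RD(4)) auto
    then show False using nonunit by simp
  qed
  have "\<exists>n. \<forall>x\<in>R. a ^ n * x \<in> U" if U: "open U" "0 \<in> U" for U
  proof (rule ccontr)
    assume no: "\<not> ?thesis"
    have cl: "closed R" by (rule compact_imp_closed_local_field[OF R(1)])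
    have "R \<inter> (\<Inter>n\<in>UNIV. (\<lambda>x. inverse a ^ n * x) -` R \<inter> - U) \<noteq> {}"
    proof (rule compact_imp_fip_image[OF R(1)])
      show "closed ((\<lambda>x. inverse a ^ n * x) -` R \<inter> - U)" for n
        using U by (intro closed_Int closed_vimage cl continuous_intros) auto
      fix J :: "nat set" assume J: "finite J"
      obtain N where N: "\<And>n. n \<in> J \<Longrightarrow> n \<le> N" using J by (meson finite_nat_set_iff_bounded_le)
      obtain x where x: "x \<in> R" "a ^ N * x \<notin> U" using no by blast
      have "inverse a ^ n * (a ^ N * x) \<in> R" if "n \<in> J" for n
      proof -
        have "inverse a ^ n * (a ^ N * x) = a ^ (N - n) * x"
          using a N[OF that] by (simp add: power_diff field_simps)
        moreover have "a ^ (N - n) * x \<in> R" using mult_R[OF power_R x(1)] a by blast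
        ultimately show ?thesis by (simp only:)
      qed
      then show "R \<inter> (\<Inter>n\<in>J. (\<lambda>x. inverse a ^ n * x) -` R \<inter> - U) \<noteq> {}"
        using x mult_R[OF power_R x(1), of a N] a by auto
    qed
    then obtain x where "x \<in> I" "x \<notin> U" by (auto simp: I_def)
    then show False using I0 U(2) by blast
  qed
  then have "contracting_scale R a"
    using R mult_R a by unfold_locales auto
  then show ?thesis by blast
qed

context contracting_scale begin

lemmas R_group = additive_subgroupD[OF subgroup_R]

text \<open>\<open>D k\<close> is \<open>p\<^sup>k R\<close>, for integers \<open>k\<close> of either sign.\<close>

definition D :: "int \<Rightarrow> 'k set" where "D k = {x. p powi (- k) * x \<in> R}"

lemma D_zero: "0 \<in> D k" and D_diff: "x \<in> D k \<Longrightarrow> y \<in> D k \<Longrightarrow> x - y \<in> D k"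
  and D_add: "x \<in> D k \<Longrightarrow> y \<in> D k \<Longrightarrow> x + y \<in> D k"
  using R_group by (auto simp: D_def algebra_simps)

lemma D_sum: "(\<And>i. i \<in> A \<Longrightarrow> f i \<in> D k) \<Longrightarrow> (\<Sum>i\<in>A. f i) \<in> D k"
  by (induction A rule: infinite_finite_induct) (auto intro: D_zero D_add)

lemma D_mult: "x \<in> D j \<Longrightarrow> y \<in> D k \<Longrightarrow> x * y \<in> D (j + k)"
  using mult_R[of "p powi (- j) * x" "p powi (- k) * y"] p_nonzero
  by (simp add: D_def power_int_diff power_int_add power_int_minus field_simps)

lemma D_powi: "p powi j * x \<in> D k \<longleftrightarrow> x \<in> D (k - j)"
  using p_nonzero by (simp add: D_def power_int_diff power_int_minus field_simps)

lemma D_0: "D 0 = R" by (simp add: D_def)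

lemma power_p_R: "p ^ n \<in> R"
  by (induction n) (auto intro: one_R mult_R p_R)

lemma D_antimono: assumes "j \<le> k" "x \<in> D k" shows "x \<in> D j"
proof -
  have "p ^ nat (k - j) * (p powi (- k) * x) \<in> R"
    by (rule mult_R[OF power_p_R]) (use assms in \<open>auto simp: D_def\<close>)
  moreover have "p ^ nat (k - j) = p powi (k - j)" using assms by (simp add: power_int_def)
  ultimately show ?thesis using p_nonzero
    by (simp add: D_def power_int_diff power_int_minus field_simps)
qed

lemma D_nat: "D (int n) = (\<lambda>x. p ^ n * x) ` R"
proof -
  have "x \<in> D (int n) \<longleftrightarrow> (\<exists>y\<in>R. x = p ^ n * y)" for x
  proof
    assume "x \<in> D (int n)"
    then show "\<exists>y\<in>R. x = p ^ n * y" using p_nonzero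
      by (intro bexI[of _ "p powi (- int n) * x"]) (auto simp: D_def power_int_minus)
  qed (use p_nonzero in \<open>auto simp: D_def power_int_minus mult.assoc[symmetric]\<close>)
  then show ?thesis by auto
qed

lemma open_D: "open (D k)"
  unfolding D_def by (rule open_scaling[OF open_R])

lemma tendsto_0_iff_D: "(f \<longlongrightarrow> 0) F \<longleftrightarrow> (\<forall>k. eventually (\<lambda>n. f n \<in> D k) F)"
proof
  assume "(f \<longlongrightarrow> 0) F"
  then show "\<forall>k. eventually (\<lambda>n. f n \<in> D k) F"
    using topological_tendstoD open_D D_zero by blast
next
  assume *: "\<forall>k. eventually (\<lambda>n. f n \<in> D k) F"
  show "(f \<longlongrightarrow> 0) F"
  proof (rule topological_tendstoI)
    fix U :: "'k set" assume "open U" "0 \<in> U"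
    then obtain n where "\<forall>x\<in>R. p ^ n * x \<in> U" using contracting by blast
    then have "D (int n) \<subseteq> U" unfolding D_nat by auto
    then show "eventually (\<lambda>n. f n \<in> U) F"
      using *[rule_format, of "int n"] by (auto elim: eventually_mono)
  qed
qed

lemma ex_D: "\<exists>k. x \<in> D k"
proof -
  have "open {y. x * y \<in> R}" by (rule open_scaling[OF open_R])
  then obtain n where "\<forall>y\<in>R. p ^ n * y \<in> {y. x * y \<in> R}"
    using contracting[of "{y. x * y \<in> R}"] R_group(1) by auto
  then have "x * p ^ n \<in> R" using one_R by auto
  then show ?thesis by (intro exI[of _ "- int n"]) (simp add: D_def mult.commute)
qed

lemma D_Inter: assumes "\<And>k. x \<in> D k" shows "x = 0"
proof (rule ccontr)
  assume "x \<noteq> 0"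
  moreover have "open (- {x})" by (intro open_Compl closed_singleton_local_field)
  ultimately obtain n where "\<forall>y\<in>R. p ^ n * y \<in> - {x}" using contracting[of "- {x}"] by auto
  moreover have "x \<in> D (int n)" by (rule assms)
  ultimately show False unfolding D_nat by auto
qed

lemma sequentially_compact_R:
  fixes s :: "nat \<Rightarrow> 'k"
  assumes s: "\<And>n. s n \<in> R"
  obtains x \<phi> where "x \<in> R" "strict_mono (\<phi> :: nat \<Rightarrow> nat)"
    "\<And>k. eventually (\<lambda>n. s (\<phi> n) - x \<in> D k) sequentially"
proof -
  have "filtermap s sequentially \<noteq> bot" by (simp add: filtermap_bot_iff)
  moreover have "eventually (\<lambda>x. x \<in> R) (filtermap s sequentially)"
    using s by (simp add: eventually_filtermap)
  ultimately obtain x where x: "x \<in> R" "inf (nhds x) (filtermap s sequentially) \<noteq> bot"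
    using compact_R[unfolded compact_filter] by blast
  have ex: "\<exists>n>N. s n - x \<in> D (int k)" for N k
  proof (rule ccontr)
    assume "\<not> ?thesis"
    then have "eventually (\<lambda>n. s n - x \<notin> D (int k)) sequentially"
      unfolding eventually_sequentially by (intro exI[of _ "Suc N"]) auto
    then have "eventually (\<lambda>y. y - x \<notin> D (int k)) (filtermap s sequentially)"
      by (simp add: eventually_filtermap)
    moreover have "eventually (\<lambda>y. y - x \<in> D (int k)) (nhds x)"
      using open_translation[OF open_D, of x "int k"] D_zero
      by (intro eventually_nhds[THEN iffD2] exI[of _ "{y. y - x \<in> D (int k)}"]) auto
    ultimately have "eventually (\<lambda>y. False) (inf (nhds x) (filtermap s sequentially))"
      unfolding eventually_inf by blast
    then show False using x(2) by (simp add: eventually_False)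
  qed
  obtain \<phi> where \<phi>: "\<And>n. \<phi> n < \<phi> (Suc n)" "\<And>n. s (\<phi> n) - x \<in> D (int n)"
    using dependent_nat_choice[of "\<lambda>n m. s m - x \<in> D (int n)" "\<lambda>_ m m'. m < m'"]
    by (metis ex)
  have "eventually (\<lambda>n. s (\<phi> n) - x \<in> D k) sequentially" for k
    unfolding eventually_sequentially
    using \<phi>(2) D_antimono by (intro exI[of _ "nat k"] allI impI) (meson nat_le_iff)
  then show ?thesis using that x(1) \<phi>(1) strict_mono_Suc_iff by blast
qed

end

section \<open>Lattices in finite-dimensional vector spaces\<close>

text \<open>Used to make finitely many bounds uniform.\<close>

lemma ex_common_lower_bound:
  fixes P :: "'i \<Rightarrow> int \<Rightarrow> bool"
  assumes "finite A" "\<And>i. i \<in> A \<Longrightarrow> \<exists>k. P i k" "\<And>i j k. j \<le> k \<Longrightarrow> P i k \<Longrightarrow> P i j"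
  shows "\<exists>k. \<forall>i\<in>A. P i k"
  using assms(1,2)
proof (induction A rule: finite_induct)
  case (insert a A)
  obtain k where k: "\<forall>i\<in>A. P i k" using insert by auto
  obtain l where l: "P a l" using insert by auto
  have "\<forall>i\<in>insert a A. P i (min k l)"
    using k l assms(3)[of "min k l" k] assms(3)[of "min k l" l] by auto
  then show ?case by blast
qed auto

text \<open>A finite-dimensional vector space with a basis \<open>B\<close> over a field with a fixed contracting scale.\<close>

locale scaled_space = finite_dimensional_vector_space smul B + contracting_scale R p
  for smul :: "'k::local_field \<Rightarrow> 'v::ab_group_add \<Rightarrow> 'v" and B :: "'v set" and R :: "'k set" and p :: 'k
begin

abbreviation lin :: "('v \<Rightarrow> 'v) \<Rightarrow> bool" where
  "lin \<equiv> Vector_Spaces.linear smul smul"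

text \<open>The lattice of those vectors whose coordinates with respect to \<open>B\<close> lie in \<open>p\<^sup>k R\<close>.\<close>

definition Lat :: "int \<Rightarrow> 'v set" where
  "Lat k = {x. \<forall>b\<in>B. representation B x b \<in> D k}"

lemmas rep_simps = representation_add[OF independent_Basis] representation_diff[OF independent_Basis]
  representation_neg[OF independent_Basis] representation_scale[OF independent_Basis]
  representation_zero

lemma Lat_zero: "0 \<in> Lat k" and Lat_diff: "x \<in> Lat k \<Longrightarrow> y \<in> Lat k \<Longrightarrow> x - y \<in> Lat k"
  and Lat_add: "x \<in> Lat k \<Longrightarrow> y \<in> Lat k \<Longrightarrow> x + y \<in> Lat k"
  by (auto simp: Lat_def rep_simps span_Basis D_zero D_diff D_add)

lemma Lat_sum: "(\<And>i. i \<in> A \<Longrightarrow> f i \<in> Lat k) \<Longrightarrow> (\<Sum>i\<in>A. f i) \<in> Lat k"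
  by (induction A rule: infinite_finite_induct) (auto intro: Lat_zero Lat_add)

lemma Lat_scale: "a \<in> D j \<Longrightarrow> x \<in> Lat k \<Longrightarrow> smul a x \<in> Lat (j + k)"
  by (auto simp: Lat_def rep_simps span_Basis D_mult)

lemma Lat_powi: "smul (p powi j) x \<in> Lat k \<longleftrightarrow> x \<in> Lat (k - j)"
  by (simp add: Lat_def rep_simps span_Basis D_powi)

lemma Lat_antimono: "j \<le> k \<Longrightarrow> x \<in> Lat k \<Longrightarrow> x \<in> Lat j"
  unfolding Lat_def using D_antimono by blast

lemma sum_rep: "(\<Sum>b\<in>B. smul (representation B x b) b) = x"
  by (rule sum_representation_eq[OF independent_Basis _ finite_Basis]) (auto simp: span_Basis)

lemma ex_Lat: "\<exists>k. x \<in> Lat k"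
  unfolding Lat_def mem_Collect_eq
  by (rule ex_common_lower_bound[OF finite_Basis ex_D]) (rule D_antimono)

lemma ex_Lat_finite: "finite A \<Longrightarrow> \<exists>k. \<forall>x\<in>A. x \<in> Lat k"
  by (rule ex_common_lower_bound) (auto intro: ex_Lat Lat_antimono)

lemma Lat_Inter: assumes "\<And>k. x \<in> Lat k" shows "x = 0"
proof -
  have "representation B x b = 0" if "b \<in> B" for b
    using assms that D_Inter[of "representation B x b"] by (auto simp: Lat_def)
  then show ?thesis using sum_rep[of x] by simp
qed

lemma linear_bounded:
  assumes "lin f"
  shows "\<exists>c. \<forall>k. \<forall>x\<in>Lat k. f x \<in> Lat (k + c)"
proof -
  interpret f: Vector_Spaces.linear smul smul f by fact
  obtain c where c: "\<And>b. b \<in> B \<Longrightarrow> f b \<in> Lat c"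
    using ex_Lat_finite[of "f ` B"] finite_Basis by auto
  have "f x \<in> Lat (k + c)" if "x \<in> Lat k" for x k
  proof -
    have "f x = (\<Sum>b\<in>B. smul (representation B x b) (f b))"
      using arg_cong[OF sum_rep[of x], of f] by (simp add: f.sum f.scale)
    also have "\<dots> \<in> Lat (k + c)"
      using that c by (intro Lat_sum Lat_scale) (auto simp: Lat_def)
    finally show ?thesis .
  qed
  then show ?thesis by blast
qed

lemma functional_bounded:
  assumes "Vector_Spaces.linear smul (*) f"
  shows "\<exists>c. \<forall>k. \<forall>x\<in>Lat k. f x \<in> D (k + c)"
proof -
  interpret f: Vector_Spaces.linear smul "(*)" f by fact
  have "\<exists>c. \<forall>b\<in>B. f b \<in> D c"
    by (rule ex_common_lower_bound[OF finite_Basis ex_D]) (rule D_antimono)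
  then obtain c where c: "\<And>b. b \<in> B \<Longrightarrow> f b \<in> D c" by blast
  have "f x \<in> D (k + c)" if "x \<in> Lat k" for x k
  proof -
    have "f x = (\<Sum>b\<in>B. representation B x b * (f b))"
      using arg_cong[OF sum_rep[of x], of f] by (simp add: f.sum f.scale)
    also have "\<dots> \<in> D (k + c)"
      using that c by (intro D_sum D_mult) (auto simp: Lat_def)
    finally show ?thesis .
  qed
  then show ?thesis by blast
qed

lemma representation_sum_Basis:
  assumes "b \<in> B"
  shows "representation B (\<Sum>b\<in>B. smul (y b) b) b = y b"
proof -
  have "representation B (\<Sum>b\<in>B. smul (y b) b) b = (\<Sum>a\<in>B. representation B (smul (y a) a) b)"
    by (subst representation_sum[OF independent_Basis]) (auto simp: span_Basis)
  also have "\<dots> = (\<Sum>a\<in>B. if a = b then y a else 0)"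
    by (intro sum.cong refl)
      (auto simp: rep_simps span_Basis representation_basis[OF independent_Basis])
  also have "\<dots> = y b" using assms finite_Basis by simp
  finally show ?thesis .
qed

lemma sequentially_compact_Lat:
  fixes s :: "nat \<Rightarrow> 'v"
  assumes s: "\<And>n. s n \<in> Lat 0"
  obtains x \<phi> where "x \<in> Lat 0" "strict_mono (\<phi> :: nat \<Rightarrow> nat)"
    "\<And>k. eventually (\<lambda>n. s (\<phi> n) - x \<in> Lat k) sequentially"
proof -
  have "\<exists>\<phi> y. strict_mono (\<phi> :: nat \<Rightarrow> nat) \<and> (\<forall>b\<in>A. y b \<in> R \<and>
      (\<forall>k. eventually (\<lambda>n. representation B (s (\<phi> n)) b - y b \<in> D k) sequentially))"
    if "finite A" "A \<subseteq> B" for A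
    using that
  proof (induction A rule: finite_induct)
    case empty
    then show ?case by (auto intro: exI[of _ id] simp: strict_mono_id)
  next
    case (insert a A)
    have "A \<subseteq> B" using insert.prems by simp
    from insert.IH[OF this] obtain \<phi> y where \<phi>: "strict_mono (\<phi> :: nat \<Rightarrow> nat)" "\<And>b. b \<in> A \<Longrightarrow> y b \<in> R"
      "\<And>b k. b \<in> A \<Longrightarrow> eventually (\<lambda>n. representation B (s (\<phi> n)) b - y b \<in> D k) sequentially"
      by blast
    have "representation B (s (\<phi> n)) a \<in> R" for n
      using s[of "\<phi> n"] insert.prems by (auto simp: Lat_def D_0)
    then obtain z \<psi> where z: "z \<in> R" "strict_mono (\<psi> :: nat \<Rightarrow> nat)"
      "\<And>k. eventually (\<lambda>n. representation B (s (\<phi> (\<psi> n))) a - z \<in> D k) sequentially"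
      using sequentially_compact_R[of "\<lambda>n. representation B (s (\<phi> n)) a"] by blast
    have "eventually (\<lambda>n. representation B (s (\<phi> (\<psi> n))) b - y b \<in> D k) sequentially" if "b \<in> A" for b k
      using eventually_subseq[OF z(2) \<phi>(3)[OF that]] .
    then show ?case
      using z \<phi>(1,2) strict_mono_o[OF \<phi>(1) z(2)] insert.hyps
      by (intro exI[of _ "\<phi> \<circ> \<psi>"] exI[of _ "y(a := z)"]) (auto simp: o_def)
  qed
  from this[OF finite_Basis order_refl] obtain \<phi> y where \<phi>: "strict_mono (\<phi> :: nat \<Rightarrow> nat)"
    "\<And>b. b \<in> B \<Longrightarrow> y b \<in> R"
    "\<And>b k. b \<in> B \<Longrightarrow> eventually (\<lambda>n. representation B (s (\<phi> n)) b - y b \<in> D k) sequentially"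
    by blast
  define x where "x = (\<Sum>b\<in>B. smul (y b) b)"
  have x: "representation B x b = y b" if "b \<in> B" for b
    using representation_sum_Basis[OF that] by (simp add: x_def)
  have "x \<in> Lat 0" using x \<phi>(2) by (simp add: Lat_def D_0)
  moreover have "eventually (\<lambda>n. s (\<phi> n) - x \<in> Lat k) sequentially" for k
  proof -
    have "eventually (\<lambda>n. \<forall>b\<in>B. representation B (s (\<phi> n)) b - y b \<in> D k) sequentially"
      using \<phi>(3) by (intro eventually_ball_finite finite_Basis) auto
    then show ?thesis
      by (rule eventually_mono) (auto simp: Lat_def rep_simps span_Basis x)
  qed
  ultimately show ?thesis using that \<phi>(1) by blast
qed

end

lemma limitin_pullback_topology:
  "limitin (pullback_topology UNIV \<phi> T) s l F \<longleftrightarrow> limitin T (\<lambda>n. \<phi> (s n)) (\<phi> l) F"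
  unfolding limitin_def by (auto simp: openin_pullback_topology topspace_pullback_topology)

context scaled_space begin

lemma limitin_canonical_topology_0_iff:
  "limitin (canonical_topology smul) s 0 sequentially \<longleftrightarrow>
    (\<forall>k. eventually (\<lambda>n. s n \<in> Lat k) sequentially)"
proof -
  have B: "is_basis smul B"
    by (simp add: is_basis_def independent_Basis span_Basis)
  have fd: "finite_dimensional smul"
    unfolding finite_dimensional_def using finite_Basis span_Basis by blast
  have "limitin (canonical_topology smul) s 0 sequentially \<longleftrightarrow>
      limitin (product_topology (\<lambda>_. euclidean) B) (\<lambda>n. coordinates smul B (s n))
        (coordinates smul B 0) sequentially"
    unfolding canonical_topology_eq[OF vector_space_axioms fd B] coordinate_topology_def
      limitin_pullback_topology ..
  also have "\<dots> \<longleftrightarrow> (\<forall>b\<in>B. ((\<lambda>n. representation B (s n) b) \<longlongrightarrow> 0) sequentially)"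
    by (simp add: limitin_componentwise coordinates_def representation_zero)
  also have "\<dots> \<longleftrightarrow> (\<forall>k. eventually (\<lambda>n. s n \<in> Lat k) sequentially)"
    unfolding tendsto_0_iff_D Lat_def mem_Collect_eq
    using finite_Basis by (auto simp: eventually_ball_finite_distrib)
  finally show ?thesis .
qed

end

section \<open>Vectors with bounded forward or backward orbits\<close>

context scaled_space begin

lemma lin_funpow: "lin h \<Longrightarrow> lin (h ^^ n)"
proof (induction n)
  case 0
  then show ?case using linear_id by (simp add: id_def)
next
  case (Suc n)
  then show ?case using Vector_Spaces.linear_compose[of smul smul "h ^^ n" smul h] by (simp add: o_def)
qed

lemma
  assumes "lin h"
  shows funpow_diff: "(h ^^ n) (x - y) = (h ^^ n) x - (h ^^ n) y"
    and funpow_add_arg: "(h ^^ n) (x + y) = (h ^^ n) x + (h ^^ n) y"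
    and funpow_scale: "(h ^^ n) (smul a x) = smul a ((h ^^ n) x)"
    and funpow_zero: "(h ^^ n) 0 = 0"
proof -
  interpret h: Vector_Spaces.linear smul smul "h ^^ n" using lin_funpow[OF assms] .
  show "(h ^^ n) (x - y) = (h ^^ n) x - (h ^^ n) y" by (rule h.diff)
  show "(h ^^ n) (x + y) = (h ^^ n) x + (h ^^ n) y" by (rule h.add)
  show "(h ^^ n) (smul a x) = smul a ((h ^^ n) x)" by (rule h.scale)
  show "(h ^^ n) 0 = 0" by (rule h.zero)
qed

end

text \<open>A linear automorphism \<open>f\<close> with its inverse \<open>g\<close>.\<close>

locale scaled_automorphism = scaled_space smul B R p
  for smul :: "'k::local_field \<Rightarrow> 'v::ab_group_add \<Rightarrow> 'v" and B :: "'v set"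
    and R :: "'k set" and p :: 'k +
  fixes f g :: "'v \<Rightarrow> 'v"
  assumes lin_f: "lin f" and lin_g: "lin g"
    and fg [simp]: "f (g x) = x" and gf [simp]: "g (f x) = x"
begin

lemma fg_pow [simp]: "(f ^^ n) ((g ^^ n) x) = x" "(g ^^ n) ((f ^^ n) x) = x"
proof -
  show "(f ^^ n) ((g ^^ n) x) = x"
    by (induction n arbitrary: x) (simp_all add: funpow_swap1)
  show "(g ^^ n) ((f ^^ n) x) = x"
    by (induction n arbitrary: x) (simp_all add: funpow_swap1)
qed

text \<open>Write \<open>L = Lat 0\<close>, \<open>L\<^sub>N = L \<inter> f L \<inter> \<dots> \<inter> f\<^sup>N L\<close>, and let \<open>E\<close> be the set of all \<open>d\<close> whose backward
orbit stays in \<open>L\<close>, that is, the intersection of all \<open>L\<^sub>n\<close>. For large \<open>N\<close>, each element of \<open>L\<^sub>N\<close>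
differs by an element of \<open>E\<close> from an element whose forward orbit stays in \<open>L\<close>.\<close>

lemma integral_decomposition:
  obtains N where "\<And>x. \<forall>i\<le>N. (g ^^ i) x \<in> Lat 0 \<Longrightarrow>
    \<exists>d. (\<forall>i. (g ^^ i) d \<in> Lat 0) \<and> (\<forall>i. (f ^^ i) (x - d) \<in> Lat 0)"
proof -
  define L where "L n = {x. \<forall>i\<le>n. (g ^^ i) x \<in> Lat 0}" for n :: nat
  define E where "E = {x. \<forall>i. (g ^^ i) x \<in> Lat 0}"
  have E_L: "d \<in> E \<Longrightarrow> d \<in> L n" for d n by (auto simp: E_def L_def)
  have L_diff: "x - y \<in> L n" if "x \<in> L n" "y \<in> L n" for x y n
    using that by (auto simp: L_def funpow_diff[OF lin_g] Lat_diff)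
  have E_add: "x + y \<in> E" if "x \<in> E" "y \<in> E" for x y
    using that by (auto simp: E_def funpow_add_arg[OF lin_g] Lat_add)
  have E_g: "g x \<in> E" if "x \<in> E" for x
    unfolding E_def
  proof safe
    fix i
    have "(g ^^ Suc i) x \<in> Lat 0" using that unfolding E_def by blast
    then show "(g ^^ i) (g x) \<in> Lat 0" by (simp add: funpow_swap1)
  qed
  have E_closed: "x \<in> E" if ev: "\<And>k. eventually (\<lambda>n. s n - x \<in> Lat k) sequentially"
      and s: "\<And>i. eventually (\<lambda>n. (g ^^ i) (s n) \<in> Lat 0) sequentially" for s x
    unfolding E_def
  proof safe
    fix i
    obtain c where c: "\<And>k x. x \<in> Lat k \<Longrightarrow> (g ^^ i) x \<in> Lat (k + c)"
      using linear_bounded[OF lin_funpow[OF lin_g]] by blast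
    have "eventually (\<lambda>n. (g ^^ i) x \<in> Lat 0) sequentially"
      using ev[of "- c"] s[of i]
    proof eventually_elim
      case (elim n)
      then have "(g ^^ i) (s n) - (g ^^ i) (s n - x) \<in> Lat 0"
        using c[of "s n - x" "- c"] by (intro Lat_diff) auto
      then show ?case by (simp add: funpow_diff[OF lin_g])
    qed
    then show "(g ^^ i) x \<in> Lat 0" by simp
  qed
  obtain m where m: "\<And>x. x \<in> Lat m \<Longrightarrow> x \<in> Lat 0 \<and> f x \<in> Lat 0"
  proof -
    obtain c where c: "\<And>k x. x \<in> Lat k \<Longrightarrow> f x \<in> Lat (k + c)"
      using linear_bounded[OF lin_f] by blast
    have "x \<in> Lat 0 \<and> f x \<in> Lat 0" if "x \<in> Lat (max 0 (- c))" for x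
      using c[OF that] Lat_antimono[OF _ that, of 0] Lat_antimono[of 0 "max 0 (- c) + c" "f x"] by auto
    then show ?thesis using that by blast
  qed
  \<comment> \<open>The decreasing compact sets \<open>L N\<close> have intersection \<open>E\<close>, so one of them lies in the open set \<open>E + (L \<inter> f\<^sup>-\<^sup>1 L)\<close>.\<close>
  have "\<exists>N. \<forall>x\<in>L N. \<exists>d\<in>E. x - d \<in> Lat 0 \<and> f (x - d) \<in> Lat 0"
  proof (rule ccontr)
    assume "\<not> ?thesis"
    then have "\<forall>N. \<exists>x\<in>L N. \<forall>d\<in>E. \<not> (x - d \<in> Lat 0 \<and> f (x - d) \<in> Lat 0)" by blast
    then obtain s where s: "\<And>N. s N \<in> L N"
      "\<And>N d. d \<in> E \<Longrightarrow> \<not> (s N - d \<in> Lat 0 \<and> f (s N - d) \<in> Lat 0)" by metis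
    have "s n \<in> Lat 0" for n using s(1)[of n] by (auto simp: L_def dest: spec[of _ 0])
    then obtain x \<phi> where x: "strict_mono (\<phi> :: nat \<Rightarrow> nat)"
      "\<And>k. eventually (\<lambda>n. s (\<phi> n) - x \<in> Lat k) sequentially"
      using sequentially_compact_Lat[of s] by blast
    have "x \<in> E"
    proof (rule E_closed[OF x(2)])
      fix i
      have "eventually (\<lambda>n. i \<le> \<phi> n) sequentially"
        using eventually_ge_at_top[of i]
        by (rule eventually_mono) (use seq_suble[OF x(1)] in \<open>blast intro: order_trans\<close>)
      then show "eventually (\<lambda>n. (g ^^ i) (s (\<phi> n)) \<in> Lat 0) sequentially"
        using s(1) by (auto simp: L_def elim: eventually_mono)
    qed
    moreover obtain n where "s (\<phi> n) - x \<in> Lat m"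
      using eventually_happens[OF x(2)[of m]] by auto
    ultimately show False using s(2) m by blast
  qed
  then obtain N where N: "\<And>x. x \<in> L N \<Longrightarrow> \<exists>d\<in>E. x - d \<in> Lat 0 \<and> f (x - d) \<in> Lat 0" by blast
  \<comment> \<open>This can be iterated, since \<open>f\<close> maps \<open>L N \<inter> f\<^sup>-\<^sup>1 L\<close> into \<open>L N\<close>, and \<open>f\<^sup>-\<^sup>1 E \<subseteq> E\<close>.\<close>
  have step: "\<exists>d\<in>E. x - d \<in> L N \<and> (\<forall>i\<le>k. (f ^^ i) (x - d) \<in> Lat 0)" if "x \<in> L N" for x k
    using that
  proof (induction k arbitrary: x)
    case 0
    have "0 \<in> E" by (simp add: E_def funpow_zero[OF lin_g] Lat_zero)
    then show ?case using 0 by (intro bexI[of _ 0]) (auto simp: L_def dest: spec[of _ 0])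
  next
    case (Suc k)
    obtain d where d: "d \<in> E" "x - d \<in> Lat 0" "f (x - d) \<in> Lat 0" using N Suc.prems by blast
    have y: "x - d \<in> L N" using Suc.prems d(1) E_L L_diff by blast
    have "f (x - d) \<in> L N"
      unfolding L_def
    proof safe
      fix i assume "i \<le> N"
      then show "(g ^^ i) (f (x - d)) \<in> Lat 0"
        using y d(3) unfolding L_def
        by (cases i) (auto simp del: funpow.simps simp: funpow_Suc_right)
    qed
    from Suc.IH[OF this] obtain e where e: "e \<in> E" "f (x - d) - e \<in> L N"
      "\<And>i. i \<le> k \<Longrightarrow> (f ^^ i) (f (x - d) - e) \<in> Lat 0" by blast
    have ge: "x - (d + g e) = g (f (x - d) - e)"
      using funpow_diff[OF lin_g, of 1 "f (x - d)" e] by (simp add: algebra_simps)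
    have "x - (d + g e) = (x - d) - g e" by (simp add: algebra_simps)
    then have 1: "x - (d + g e) \<in> L N" using y E_L[OF E_g[OF e(1)]] L_diff by metis
    have "(f ^^ i) (x - (d + g e)) \<in> Lat 0" if "i \<le> Suc k" for i
    proof (cases i)
      case 0
      then show ?thesis using 1 by (auto simp: L_def dest: spec[of _ 0])
    next
      case (Suc j)
      then show ?thesis using e(3)[of j] that unfolding ge 
        by (simp del: funpow.simps add: funpow_Suc_right)
    qed
    then show ?case using 1 E_add[OF d(1) E_g[OF e(1)]] by blast
  qed
  have "\<exists>d. d \<in> E \<and> (\<forall>i. (f ^^ i) (x - d) \<in> Lat 0)" if x: "x \<in> L N" for x
  proof -
    \<comment> \<open>A cluster point of the elements of \<open>E\<close> found for each \<open>k\<close> works for all \<open>k\<close> at once.\<close>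
    obtain s where s: "\<And>k. s k \<in> E" "\<And>k i. i \<le> k \<Longrightarrow> (f ^^ i) (x - s k) \<in> Lat 0"
      using step[OF x] by metis
    have "s n \<in> Lat 0" for n using s(1)[of n] by (auto simp: E_def dest: spec[of _ 0])
    then obtain d \<phi> where d: "strict_mono (\<phi> :: nat \<Rightarrow> nat)"
      "\<And>k. eventually (\<lambda>n. s (\<phi> n) - d \<in> Lat k) sequentially"
      using sequentially_compact_Lat[of s] by blast
    have "d \<in> E" using s(1) by (intro E_closed[OF d(2)]) (auto simp: E_def)
    moreover have "(f ^^ i) (x - d) \<in> Lat 0" for i
    proof -
      obtain c where c: "\<And>k x. x \<in> Lat k \<Longrightarrow> (f ^^ i) x \<in> Lat (k + c)"
        using linear_bounded[OF lin_funpow[OF lin_f]] by blast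
      have "eventually (\<lambda>n. (f ^^ i) (x - d) \<in> Lat 0) sequentially"
        using d(2)[of "- c"] eventually_ge_at_top[of i]
      proof eventually_elim
        case (elim n)
        have "i \<le> \<phi> n" using elim(2) seq_suble[OF d(1), of n] by simp
        then have "(f ^^ i) (x - s (\<phi> n)) + (f ^^ i) (s (\<phi> n) - d) \<in> Lat 0"
          using c[OF elim(1)] s(2) by (intro Lat_add) auto
        then show ?case by (simp add: funpow_diff[OF lin_f])
      qed
      then show ?thesis by simp
    qed
    ultimately show ?thesis by blast
  qed
  then show ?thesis by (intro that[of N]) (auto simp: L_def E_def)
qed

lemma bounded_decomposition:
  "\<exists>y z. x = y + z \<and> (\<exists>c. \<forall>n. (f ^^ n) y \<in> Lat c) \<and> (\<exists>c. \<forall>n. (g ^^ n) z \<in> Lat c)"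
proof -
  obtain N where N: "\<And>x. \<forall>i\<le>N. (g ^^ i) x \<in> Lat 0 \<Longrightarrow>
    \<exists>d. (\<forall>i. (g ^^ i) d \<in> Lat 0) \<and> (\<forall>i. (f ^^ i) (x - d) \<in> Lat 0)"
    using integral_decomposition by blast
  obtain c where c: "\<And>i. i \<le> N \<Longrightarrow> (g ^^ i) x \<in> Lat c"
    using ex_Lat_finite[of "(\<lambda>i. (g ^^ i) x) ` {..N}"] by auto
  define q where "q = p powi (- c)"
  have q: "smul (p powi c) (smul q v) = v" for v
  proof -
    have "p powi c * q = 1" using p_nonzero by (simp add: q_def power_int_minus)
    then show ?thesis by simp
  qed
  have "\<forall>i\<le>N. (g ^^ i) (smul q x) \<in> Lat 0"
    using c by (simp add: q_def funpow_scale[OF lin_g] Lat_powi)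
  from N[OF this] obtain d where d: "\<And>i. (g ^^ i) d \<in> Lat 0" "\<And>i. (f ^^ i) (smul q x - d) \<in> Lat 0"
    by blast
  show ?thesis
  proof (intro exI conjI allI)
    show "x = smul (p powi c) (smul q x - d) + smul (p powi c) d"
      using q[of x] by (simp only: scale_right_diff_distrib diff_add_cancel)
    show "(f ^^ n) (smul (p powi c) (smul q x - d)) \<in> Lat c" for n
      using d(2)[of n] by (simp only: funpow_scale[OF lin_f] Lat_powi) simp
    show "(g ^^ n) (smul (p powi c) d) \<in> Lat c" for n
      using d(1)[of n] by (simp only: funpow_scale[OF lin_g] Lat_powi) simp
  qed
qed

end

section \<open>Decay rates of orbits\<close>

context scaled_space begin

text \<open>The vectors whose orbit under \<open>h\<close> decays at rate at least \<open>s\<close>: up to a constant \<open>c\<close> depending on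
\<open>x\<close>, the \<open>n\<close>-th iterate lies in the lattice of index \<open>s n\<close>. The quantification over all integers
\<open>k\<close> below \<open>s n - c\<close> avoids rounding.\<close>

definition decay :: "('v \<Rightarrow> 'v) \<Rightarrow> real \<Rightarrow> 'v set" where
  "decay h s = {x. \<exists>c. \<forall>n k. real_of_int k \<le> s * real n - c \<longrightarrow> (h ^^ n) x \<in> Lat k}"

lemma decayI:
  assumes "\<And>n k. real_of_int k \<le> s * real n - c \<Longrightarrow> (h ^^ n) x \<in> Lat k"
  shows "x \<in> decay h s"
  using assms unfolding decay_def by blast

lemma decayE:
  assumes "x \<in> decay h s"
  obtains c where "\<And>n k. real_of_int k \<le> s * real n - c \<Longrightarrow> (h ^^ n) x \<in> Lat k"
  using assms unfolding decay_def by blast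

lemma decay_antimono: assumes "s \<le> t" shows "decay h t \<subseteq> decay h s"
proof
  fix x assume "x \<in> decay h t"
  then obtain c where c: "\<And>n k. real_of_int k \<le> t * real n - c \<Longrightarrow> (h ^^ n) x \<in> Lat k"
    by (rule decayE) blast
  show "x \<in> decay h s"
  proof (rule decayI)
    fix n k assume "real_of_int k \<le> s * real n - c"
    moreover have "s * real n \<le> t * real n" using assms by (rule mult_right_mono) simp
    ultimately show "(h ^^ n) x \<in> Lat k" by (intro c) simp
  qed
qed

lemma subspace_decay:
  assumes "lin h" shows "subspace (decay h s)"
proof (rule subspaceI)
  show "0 \<in> decay h s" by (rule decayI) (simp add: funpow_zero[OF assms] Lat_zero)
next
  fix x y assume "x \<in> decay h s" "y \<in> decay h s"
  obtain c where c: "\<And>n k. real_of_int k \<le> s * real n - c \<Longrightarrow> (h ^^ n) x \<in> Lat k"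
    using \<open>x \<in> decay h s\<close> by (rule decayE) blast
  obtain d where d: "\<And>n k. real_of_int k \<le> s * real n - d \<Longrightarrow> (h ^^ n) y \<in> Lat k"
    using \<open>y \<in> decay h s\<close> by (rule decayE) blast
  show "x + y \<in> decay h s"
    by (rule decayI[of s "max c d"]) (auto simp: funpow_add_arg[OF assms] intro!: Lat_add c d)
next
  fix a x assume "x \<in> decay h s"
  then obtain c where c: "\<And>n k. real_of_int k \<le> s * real n - c \<Longrightarrow> (h ^^ n) x \<in> Lat k"
    by (rule decayE) blast
  obtain j where j: "a \<in> D j" using ex_D by blast
  show "smul a x \<in> decay h s"
  proof (rule decayI)
    fix n k assume "real_of_int k \<le> s * real n - (c - real_of_int j)"
    then have "(h ^^ n) x \<in> Lat (k - j)" by (intro c) simp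
    from Lat_scale[OF j this] show "(h ^^ n) (smul a x) \<in> Lat k"
      by (simp add: funpow_scale[OF assms])
  qed
qed

lemma decay_linear:
  assumes "lin u" "\<And>x. u (h x) = h (u x)" "x \<in> decay h s"
  shows "u x \<in> decay h s"
proof -
  obtain c where c: "\<And>n k. real_of_int k \<le> s * real n - c \<Longrightarrow> (h ^^ n) x \<in> Lat k"
    using assms(3) by (rule decayE) blast
  obtain d where d: "\<And>k x. x \<in> Lat k \<Longrightarrow> u x \<in> Lat (k + d)"
    using linear_bounded[OF assms(1)] by blast
  have comm: "(h ^^ n) (u x) = u ((h ^^ n) x)" for n
    by (induction n) (simp_all add: assms(2))
  show ?thesis
  proof (rule decayI)
    fix n k assume "real_of_int k \<le> s * real n - (c - real_of_int d)"
    then have "(h ^^ n) x \<in> Lat (k - d)" by (intro c) simp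
    from d[OF this] show "(h ^^ n) (u x) \<in> Lat k" by (simp add: comm)
  qed
qed

text \<open>A rate \<open>m/e\<close> can be checked along the multiples of \<open>e\<close>.\<close>

lemma decay_from_power:
  assumes h: "lin h" and e: "e > 0" and c: "\<And>n. (h ^^ (e * n)) x \<in> Lat (c + m * int n)"
  shows "x \<in> decay h (of_int m / real e)"
proof -
  have "\<exists>d. \<forall>i\<in>{..<e}. \<forall>k. \<forall>x\<in>Lat k. (h ^^ i) x \<in> Lat (k + d)"
  proof (rule ex_common_lower_bound)
    show "\<exists>d. \<forall>k. \<forall>x\<in>Lat k. (h ^^ i) x \<in> Lat (k + d)" for i
      using linear_bounded[OF lin_funpow[OF h]] .
  next
    fix i and d d' :: int
    assume "d' \<le> d" "\<forall>k. \<forall>x\<in>Lat k. (h ^^ i) x \<in> Lat (k + d)"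
    then show "\<forall>k. \<forall>x\<in>Lat k. (h ^^ i) x \<in> Lat (k + d')"
      using Lat_antimono[of "k + d'" "k + d" for k] by (meson add_left_mono)
  qed auto
  then obtain d where d: "\<And>i k x. i < e \<Longrightarrow> x \<in> Lat k \<Longrightarrow> (h ^^ i) x \<in> Lat (k + d)"
    by auto
  show ?thesis
  proof (rule decayI)
    fix n k assume k: "real_of_int k \<le> of_int m / real e * real n - (\<bar>of_int m\<bar> - of_int c - of_int d)"
    define q i where "q = n div e" and "i = n mod e"
    have n: "n = i + e * q" and i: "i < e" using e by (auto simp: q_def i_def)
    have "(h ^^ n) x = (h ^^ i) ((h ^^ (e * q)) x)" by (simp add: n funpow_add)
    then have mem: "(h ^^ n) x \<in> Lat (c + m * int q + d)" using d[OF i c] by simp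
    have "of_int m / real e * real n = of_int m * real q + of_int m * (real i / real e)"
      using e by (simp add: n field_simps)
    moreover have "of_int m * (real i / real e) \<le> \<bar>of_int m\<bar>"
    proof -
      have "\<bar>of_int m * (real i / real e)\<bar> = \<bar>of_int m\<bar> * (real i / real e)" by (simp add: abs_mult)
      also have "\<dots> \<le> \<bar>of_int m\<bar> * 1" using i by (intro mult_left_mono) auto
      finally show ?thesis by linarith
    qed
    ultimately have "real_of_int k \<le> of_int m * real q + of_int c + of_int d" using k by linarith
    then have "real_of_int k \<le> real_of_int (c + m * int q + d)" by simp
    then have "k \<le> c + m * int q + d" by (simp only: of_int_le_iff)
    then show "(h ^^ n) x \<in> Lat k" using mem by (rule Lat_antimono)
  qed
qed

text \<open>On a subspace, the constant in the definition of the decay rate can be chosen uniformly for all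
its vectors, relative to their size: expand them in a basis of the subspace, whose coordinate functions are
bounded.\<close>

lemma decay_uniform:
  assumes h: "lin h" and S: "subspace S" "S \<subseteq> decay h s"
  shows "\<exists>c. \<forall>j. \<forall>x\<in>S \<inter> Lat j. \<forall>n k. real_of_int k \<le> s * real n - c \<longrightarrow> (h ^^ n) x \<in> Lat (j + k)"
proof -
  obtain C where C: "C \<subseteq> S" "independent C" "S \<subseteq> span C"
    by (rule basis_exists)
  have finC: "finite C" using C(2) by (rule finiteI_independent)
  define E where "E = extend_basis C"
  have E: "independent E" "span E = UNIV" "C \<subseteq> E"
    using C(2) by (auto simp: E_def independent_extend_basis extend_basis_superset)
  have "\<exists>d. \<forall>b\<in>C. \<forall>k. \<forall>x\<in>Lat k. representation E x b \<in> D (k + d)"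
  proof (rule ex_common_lower_bound[OF finC])
    show "\<exists>d. \<forall>k. \<forall>x\<in>Lat k. representation E x b \<in> D (k + d)" for b
      using functional_bounded[OF linear_representation[OF E(1,2)]] .
  next
    fix b and d d' :: int
    assume "d' \<le> d" "\<forall>k. \<forall>x\<in>Lat k. representation E x b \<in> D (k + d)"
    then show "\<forall>k. \<forall>x\<in>Lat k. representation E x b \<in> D (k + d')"
      using D_antimono[of "k + d'" "k + d" for k] by (meson add_left_mono)
  qed
  then obtain d where d: "\<And>b k x. b \<in> C \<Longrightarrow> x \<in> Lat k \<Longrightarrow> representation E x b \<in> D (k + d)"
    by blast
  have "\<exists>l. \<forall>b\<in>C. \<forall>n k. real_of_int k \<le> s * real n + of_int l \<longrightarrow> (h ^^ n) b \<in> Lat k"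
  proof (rule ex_common_lower_bound[OF finC])
    fix b assume "b \<in> C"
    then have "b \<in> decay h s" using C(1) S(2) by blast
    then obtain c where c: "\<And>n k. real_of_int k \<le> s * real n - c \<Longrightarrow> (h ^^ n) b \<in> Lat k"
      by (rule decayE) blast
    have "\<forall>n k. real_of_int k \<le> s * real n + of_int \<lfloor>- c\<rfloor> \<longrightarrow> (h ^^ n) b \<in> Lat k"
      by (intro allI impI c) linarith
    then show "\<exists>l. \<forall>n k. real_of_int k \<le> s * real n + of_int l \<longrightarrow> (h ^^ n) b \<in> Lat k" by blast
  next
    fix b and l l' :: int
    assume "l' \<le> l" "\<forall>n k. real_of_int k \<le> s * real n + of_int l \<longrightarrow> (h ^^ n) b \<in> Lat k"
    then show "\<forall>n k. real_of_int k \<le> s * real n + of_int l' \<longrightarrow> (h ^^ n) b \<in> Lat k"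
      by (meson add_left_mono of_int_le_iff order_trans)
  qed
  then obtain l where l: "\<And>b n k. b \<in> C \<Longrightarrow> real_of_int k \<le> s * real n + of_int l \<Longrightarrow> (h ^^ n) b \<in> Lat k"
    by blast
  show ?thesis
  proof (intro exI allI ballI impI)
    fix j x n k assume x: "x \<in> S \<inter> Lat j"
      and k: "real_of_int k \<le> s * real n - (- of_int l - of_int d)"
    interpret hn: Vector_Spaces.linear smul smul "h ^^ n" using lin_funpow[OF h] .
    have xC: "x \<in> span C" using x C(3) by blast
    have "representation E x = representation C x"
      using representation_extend[OF E(1) xC E(3)] .
    then have "x = (\<Sum>b\<in>C. smul (representation E x b) b)"
      using sum_representation_eq[OF C(2) xC finC order_refl] by simp
    then have "(h ^^ n) x = (\<Sum>b\<in>C. smul (representation E x b) ((h ^^ n) b))"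
      using hn.sum hn.scale by (metis (no_types, lifting) sum.cong)
    also have "\<dots> \<in> Lat (j + k)"
    proof (rule Lat_sum)
      fix b assume b: "b \<in> C"
      have "(h ^^ n) b \<in> Lat (k - d)" using k by (intro l[OF b]) simp
      from Lat_scale[OF d[OF b, of x j] this]
      show "smul (representation E x b) ((h ^^ n) b) \<in> Lat (j + k)" using x by simp
    qed
    finally show "(h ^^ n) x \<in> Lat (j + k)" .
  qed
qed

end

context scaled_automorphism begin

text \<open>The vectors with both rates form an invariant subspace \<open>S\<close>. By uniformity, going \<open>n\<close> steps
backward and then \<open>n\<close> steps forward maps \<open>S \<inter> Lat j\<close> into \<open>Lat (j + 1)\<close> for large \<open>n\<close>; but this
is the identity map.\<close>

lemma decay_Int_trivial:
  assumes st: "s + t > 0" and x: "x \<in> decay f s" "x \<in> decay g t"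
  shows "x = 0"
proof -
  define S where "S = decay f s \<inter> decay g t"
  have S: "subspace S" unfolding S_def by (intro subspace_inter subspace_decay lin_f lin_g)
  obtain c where c: "\<And>j x n k. x \<in> S \<Longrightarrow> x \<in> Lat j \<Longrightarrow> real_of_int k \<le> s * real n - c \<Longrightarrow>
      (f ^^ n) x \<in> Lat (j + k)"
    using decay_uniform[OF lin_f S, of s] unfolding S_def by blast
  obtain d where d: "\<And>j x n k. x \<in> S \<Longrightarrow> x \<in> Lat j \<Longrightarrow> real_of_int k \<le> t * real n - d \<Longrightarrow>
      (g ^^ n) x \<in> Lat (j + k)"
    using decay_uniform[OF lin_g S, of t] unfolding S_def by blast
  have g_S: "(g ^^ n) y \<in> S" if "y \<in> S" for n y
  proof (induction n)
    case (Suc n)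
    then show ?case
      using decay_linear[OF lin_g, of f "(g ^^ n) y" s] decay_linear[OF lin_g, of g "(g ^^ n) y" t]
      by (simp add: S_def)
  qed (use that in simp)
  obtain n :: nat where n: "(c + d + 3) / (s + t) \<le> real n" using real_arch_simple by blast
  have n': "c + d + 3 \<le> s * real n + t * real n" using n st by (simp add: field_simps)
  define k l where "k = \<lfloor>s * real n - c\<rfloor>" and "l = \<lfloor>t * real n - d\<rfloor>"
  have kl: "l + k \<ge> 1"
    using n' unfolding k_def l_def by linarith
  have step: "y \<in> Lat (j + 1)" if y: "y \<in> S" "y \<in> Lat j" for y j
  proof -
    have "(g ^^ n) y \<in> Lat (j + l)" by (rule d[OF y]) (simp add: l_def)
    then have "(f ^^ n) ((g ^^ n) y) \<in> Lat (j + l + k)"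
      by (rule c[OF g_S[OF y(1)]]) (simp add: k_def)
    then have "y \<in> Lat (j + l + k)" by simp
    then show ?thesis by (rule Lat_antimono[rotated]) (use kl in simp)
  qed
  have xS: "x \<in> S" using x by (simp add: S_def)
  obtain j where j: "x \<in> Lat j" using ex_Lat by blast
  have all: "x \<in> Lat (j + int i)" for i
  proof (induction i)
    case (Suc i)
    then show ?case using step[OF xS, of "j + int i"] by (simp add: algebra_simps)
  qed (use j in simp)
  show ?thesis
  proof (rule Lat_Inter)
    fix k
    show "x \<in> Lat k" using all[of "nat (k - j)"] by (rule Lat_antimono[rotated]) simp
  qed
qed

text \<open>The decomposition into vectors with bounded forward and backward orbits, for the automorphism
\<open>p\<^sup>-\<^sup>m f\<^sup>e\<close>.\<close>

lemma rational_decomposition: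
  assumes e: "e > 0"
  shows "\<exists>y\<in>decay f (of_int m / real e). \<exists>z\<in>decay g (- (of_int m / real e)). x = y + z"
proof -
  define F G where "F x = smul (p powi (- m)) ((f ^^ e) x)" and
    "G x = smul (p powi m) ((g ^^ e) x)" for x
  have lin_smul: "lin (\<lambda>x. smul a x)" for a
    by (rule linear_scale_self)
  have linFG: "lin F" "lin G"
    using Vector_Spaces.linear_compose[OF lin_funpow[OF lin_f] lin_smul]
      Vector_Spaces.linear_compose[OF lin_funpow[OF lin_g] lin_smul]
    by (auto simp: F_def[abs_def] G_def[abs_def] o_def)
  have pp: "p powi (- m) * p powi m = 1" using p_nonzero by (simp add: power_int_minus)
  have FG: "F (G x) = x" "G (F x) = x" for x
    using pp by (simp_all add: F_def G_def funpow_scale[OF lin_f] funpow_scale[OF lin_g] mult.commute)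
  interpret FG: scaled_automorphism smul B R p F G
    by (intro scaled_automorphism.intro scaled_automorphism_axioms.intro
      scaled_space_axioms linFG FG)
  have pow: "p powi (j * int (Suc n)) = p powi j * p powi (j * int n)" for j n
    using p_nonzero by (simp add: power_int_add distrib_left)
  have Fn: "(F ^^ n) x = smul (p powi (- m * int n)) ((f ^^ (e * n)) x)" for n x
    by (induction n) (simp_all only: pow, simp_all add: F_def funpow_add funpow_scale[OF lin_f])
  have Gn: "(G ^^ n) x = smul (p powi (m * int n)) ((g ^^ (e * n)) x)" for n x
    by (induction n) (simp_all only: pow, simp_all add: G_def funpow_add funpow_scale[OF lin_g])
  obtain y z c d where yz: "x = y + z" "\<And>n. (F ^^ n) y \<in> Lat c" "\<And>n. (G ^^ n) z \<in> Lat d"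
    using FG.bounded_decomposition[of x] by blast
  have "y \<in> decay f (of_int m / real e)"
  proof (rule decay_from_power[OF lin_f e])
    show "(f ^^ (e * n)) y \<in> Lat (c + m * int n)" for n
      using yz(2)[of n] unfolding Fn Lat_powi by simp
  qed
  moreover have "z \<in> decay g (of_int (- m) / real e)"
  proof (rule decay_from_power[OF lin_g e])
    show "(g ^^ (e * n)) z \<in> Lat (d + (- m) * int n)" for n
      using yz(3)[of n] unfolding Gn Lat_powi by simp
  qed
  ultimately show ?thesis using yz(1) by auto
qed

end

section \<open>Decomposition by decay rates\<close>

context scaled_space begin

text \<open>The vectors decaying at each rate smaller than \<open>r\<close>. In contrast to \<open>decay h r\<close>, subexponential
corrections are allowed, so that \<open>r\<close> can be an arbitrary real number.\<close>

definition slope_ge :: "('v \<Rightarrow> 'v) \<Rightarrow> real \<Rightarrow> 'v set" where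
  "slope_ge h r = (\<Inter>s\<in>{..<r}. decay h s)"

lemma subspace_slope_ge: "lin h \<Longrightarrow> subspace (slope_ge h r)"
  unfolding slope_ge_def by (intro subspace_Inter) (auto intro: subspace_decay)

lemma slope_ge_antimono: "r \<le> r' \<Longrightarrow> slope_ge h r' \<subseteq> slope_ge h r"
  by (auto simp: slope_ge_def)

lemma decay_subset_slope_ge: "r \<le> s \<Longrightarrow> decay h s \<subseteq> slope_ge h r"
  unfolding slope_ge_def by (intro INT_greatest decay_antimono) simp

lemma slope_ge_subset_decay: "s < r \<Longrightarrow> slope_ge h r \<subseteq> decay h s"
  by (auto simp: slope_ge_def)

text \<open>By finite dimension, the decreasing family of the subspaces \<open>decay h s\<close> is constant for \<open>s < r\<close>
close to \<open>r\<close>.\<close>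

lemma slope_ge_eq_decay:
  assumes h: "lin h"
  obtains s where "s < r" "slope_ge h r = decay h s"
proof -
  obtain s where s: "s < r" and min: "\<And>t. t < r \<Longrightarrow> dim (decay h s) \<le> dim (decay h t)"
    using ex_has_least_nat[of "\<lambda>s. s < r" "r - 1" "\<lambda>s. dim (decay h s)"] by auto
  have "decay h s \<subseteq> decay h t" if t: "t < r" for t
  proof (cases "t \<le> s")
    case False
    then have "decay h t = decay h s"
      using decay_antimono[of s t h] min[OF t]
      by (intro subspace_dim_equal subspace_decay h) auto
    then show ?thesis by simp
  qed (rule decay_antimono)
  then have "slope_ge h r = decay h s" using s by (auto simp: slope_ge_def)
  then show ?thesis using s that by blast
qed

text \<open>A bilinear map is bounded with respect to the lattices, so if it is compatible with \<open>h\<close>, then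
rates add.\<close>

lemma slope_ge_bilinear:
  assumes lin1: "\<And>y. lin (\<lambda>x. br x y)" and lin2: "\<And>x. lin (br x)"
    and h: "\<And>x y. h (br x y) = br (h x) (h y)"
    and x: "x \<in> slope_ge h r" and y: "y \<in> slope_ge h s"
  shows "br x y \<in> slope_ge h (r + s)"
proof -
  have "\<exists>c. \<forall>b\<in>B. \<forall>k. \<forall>y\<in>Lat k. br b y \<in> Lat (k + c)"
  proof (rule ex_common_lower_bound[OF finite_Basis])
    show "\<exists>c. \<forall>k. \<forall>y\<in>Lat k. br b y \<in> Lat (k + c)" for b
      using linear_bounded[OF lin2] .
  next
    fix b and d d' :: int
    assume "d' \<le> d" "\<forall>k. \<forall>y\<in>Lat k. br b y \<in> Lat (k + d)"
    then show "\<forall>k. \<forall>y\<in>Lat k. br b y \<in> Lat (k + d')"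
      using Lat_antimono[of "k + d'" "k + d" for k] by (meson add_left_mono)
  qed
  then obtain c where c: "\<And>b k y. b \<in> B \<Longrightarrow> y \<in> Lat k \<Longrightarrow> br b y \<in> Lat (k + c)" by blast
  have bounded: "br x y \<in> Lat (j + (k + c))" if "x \<in> Lat j" "y \<in> Lat k" for x y j k
  proof -
    interpret l: Vector_Spaces.linear smul smul "\<lambda>x. br x y" by (rule lin1)
    have "br x y = (\<Sum>b\<in>B. smul (representation B x b) (br b y))"
      using arg_cong[OF sum_rep[of x], of "\<lambda>x. br x y"] by (simp add: l.sum l.scale)
    also have "\<dots> \<in> Lat (j + (k + c))"
    proof (rule Lat_sum)
      fix b assume b: "b \<in> B"
      have "representation B x b \<in> D j" using that(1) b by (auto simp: Lat_def)
      from Lat_scale[OF this c[OF b that(2)]]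
      show "smul (representation B x b) (br b y) \<in> Lat (j + (k + c))" .
    qed
    finally show ?thesis .
  qed
  have pow: "(h ^^ n) (br x y) = br ((h ^^ n) x) ((h ^^ n) y)" for n
    by (induction n) (simp_all add: h)
  show ?thesis
    unfolding slope_ge_def
  proof safe
    fix u assume u: "u < r + s"
    define e where "e = (r + s - u) / 2"
    have e: "e > 0" "u = (r - e) + (s - e)" using u by (simp_all add: e_def)
    have "x \<in> decay h (r - e)" using x e slope_ge_subset_decay[of "r - e" r h] by auto
    then obtain cx where cx: "\<And>n k. real_of_int k \<le> (r - e) * real n - cx \<Longrightarrow> (h ^^ n) x \<in> Lat k"
      by (rule decayE) blast
    have "y \<in> decay h (s - e)" using y e slope_ge_subset_decay[of "s - e" s h] by auto
    then obtain cy where cy: "\<And>n k. real_of_int k \<le> (s - e) * real n - cy \<Longrightarrow> (h ^^ n) y \<in> Lat k"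
      by (rule decayE) blast
    show "br x y \<in> decay h u"
    proof (rule decayI)
      fix n k assume k: "real_of_int k \<le> u * real n - (cx + cy + 2 - of_int c)"
      define i j where "i = \<lfloor>(r - e) * real n - cx\<rfloor>" and "j = \<lfloor>(s - e) * real n - cy\<rfloor>"
      have "(h ^^ n) x \<in> Lat i" "(h ^^ n) y \<in> Lat j"
        by (auto intro!: cx cy simp: i_def j_def)
      then have "(h ^^ n) (br x y) \<in> Lat (i + (j + c))" unfolding pow by (rule bounded)
      moreover have "k \<le> i + (j + c)"
      proof -
        have "u * real n = (r - e) * real n + (s - e) * real n"
          unfolding e(2) by (rule distrib_right)
        then show ?thesis using k unfolding i_def j_def by linarith
      qed
      ultimately show "(h ^^ n) (br x y) \<in> Lat k" by (rule Lat_antimono[rotated])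
    qed
  qed
qed

end

context scaled_automorphism begin

text \<open>The vectors whose orbit has exact rate \<open>r\<close> in both time directions. Backward iterates of such
vectors grow at rate \<open>r\<close>, that is, decay at rate \<open>- r\<close>.\<close>

definition slope :: "real \<Rightarrow> 'v set" where
  "slope r = slope_ge f r \<inter> slope_ge g (- r)"

lemma subspace_slope: "subspace (slope r)"
  unfolding slope_def by (intro subspace_inter subspace_slope_ge lin_f lin_g)

text \<open>Split at a rational rate below \<open>r\<close> that is so close to \<open>r\<close> that vectors of this forward rate
already lie in \<open>slope_ge f r\<close>.\<close>

lemma slope_decomposition: "\<exists>y\<in>slope_ge f r. \<exists>z\<in>slope_ge g (- r). x = y + z"
proof -
  obtain s where s: "s < r" "slope_ge f r = decay f s" by (rule slope_ge_eq_decay[OF lin_f])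
  obtain q where q: "q \<in> \<rat>" "s < q" "q < r" using Rats_dense_in_real[OF s(1)] by blast
  obtain m :: int and e where e: "q = of_int m / real e" "e > 0"
    using q(1) by (rule Rats_cases') (metis of_int_of_nat_eq zero_less_imp_eq_int of_nat_0_less_iff)
  have "decay f q \<subseteq> slope_ge f r" unfolding s(2) using q(2) by (intro decay_antimono) simp
  moreover have "decay g (- q) \<subseteq> slope_ge g (- r)" using q(3) by (intro decay_subset_slope_ge) simp
  ultimately show ?thesis
    using rational_decomposition[OF e(2), of m x] unfolding e(1) by blast
qed

text \<open>A vector whose forward and backward rates confine it to a short interval around \<open>r\<close> has rate \<open>r\<close>.\<close>

lemma slope_local:
  "\<exists>d>0. \<forall>a b. a \<le> r \<and> r \<le> b \<and> b - a < d \<longrightarrow> slope_ge f a \<inter> slope_ge g (- b) \<subseteq> slope r"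
proof -
  obtain s where s: "s < r" "slope_ge f r = decay f s" by (rule slope_ge_eq_decay[OF lin_f])
  obtain t where t: "t < - r" "slope_ge g (- r) = decay g t" by (rule slope_ge_eq_decay[OF lin_g])
  have "slope_ge f a \<inter> slope_ge g (- b) \<subseteq> slope r"
    if "a \<le> r" "r \<le> b" "b - a < min (r - s) (- r - t)" for a b
    using that slope_ge_subset_decay[of s a f] slope_ge_subset_decay[of t "- b" g]
    by (auto simp: slope_def s(2) t(2))
  then show ?thesis using s(1) t(1) by (intro exI[of _ "min (r - s) (- r - t)"]) auto
qed

text \<open>Splitting at an intermediate rate shows that the assertion is additive in the interval, and it
holds for short intervals by \<open>slope_local\<close>. Hence bisection applies.\<close>

lemma slope_span:
  assumes "a \<le> b"
  shows "\<exists>F. finite F \<and> F \<subseteq> {a..b} \<and> slope_ge f a \<inter> slope_ge g (- b) \<subseteq> span (\<Union>r\<in>F. slope r)"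
proof -
  define P where "P c d \<longleftrightarrow> (a \<le> c \<longrightarrow> d \<le> b \<longrightarrow>
    (\<exists>F. finite F \<and> F \<subseteq> {a..b} \<and> slope_ge f c \<inter> slope_ge g (- d) \<subseteq> span (\<Union>r\<in>F. slope r)))" for c d
  have "P a b"
    using assms
  proof (induction rule: Bolzano)
    case (trans c d e)
    show ?case
      unfolding P_def
    proof (intro impI)
      assume ce: "a \<le> c" "e \<le> b"
      obtain F where F: "finite F" "F \<subseteq> {a..b}"
        "slope_ge f c \<inter> slope_ge g (- d) \<subseteq> span (\<Union>r\<in>F. slope r)"
        using trans ce unfolding P_def by (meson order_trans)
      obtain F' where F': "finite F'" "F' \<subseteq> {a..b}"
        "slope_ge f d \<inter> slope_ge g (- e) \<subseteq> span (\<Union>r\<in>F'. slope r)"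
        using trans ce unfolding P_def by (meson order_trans)
      have sub: "span (\<Union>r\<in>F. slope r) \<subseteq> span (\<Union>r\<in>F \<union> F'. slope r)"
        "span (\<Union>r\<in>F'. slope r) \<subseteq> span (\<Union>r\<in>F \<union> F'. slope r)"
        by (intro span_mono; auto)+
      have "x \<in> span (\<Union>r\<in>F \<union> F'. slope r)" if x: "x \<in> slope_ge f c" "x \<in> slope_ge g (- e)" for x
      proof -
        obtain y z where yz: "y \<in> slope_ge f d" "z \<in> slope_ge g (- d)" "x = y + z"
          using slope_decomposition by blast
        have "y \<in> slope_ge f c" using yz(1) slope_ge_antimono[of c d f] trans by blast
        then have "x - y \<in> slope_ge f c" using x(1) by (intro subspace_diff subspace_slope_ge lin_f)
        then have "z \<in> slope_ge f c \<inter> slope_ge g (- d)" using yz by simp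
        moreover have "z \<in> slope_ge g (- e)" using yz(2) slope_ge_antimono[of "- e" "- d" g] trans by auto
        then have "x - z \<in> slope_ge g (- e)" using x(2) by (intro subspace_diff subspace_slope_ge lin_g)
        then have "y \<in> slope_ge f d \<inter> slope_ge g (- e)" using yz by simp
        ultimately have "y \<in> span (\<Union>r\<in>F \<union> F'. slope r)" "z \<in> span (\<Union>r\<in>F \<union> F'. slope r)"
          using F(3) F'(3) sub by blast+
        then show ?thesis unfolding yz(3) by (rule span_add)
      qed
      then show "\<exists>F. finite F \<and> F \<subseteq> {a..b} \<and> slope_ge f c \<inter> slope_ge g (- e) \<subseteq> span (\<Union>r\<in>F. slope r)"
        using F F' by (intro exI[of _ "F \<union> F'"]) auto
    qed
  next
    case (local r)
    obtain d where d: "d > 0" "\<And>c e. c \<le> r \<Longrightarrow> r \<le> e \<Longrightarrow> e - c < d \<Longrightarrow>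
        slope_ge f c \<inter> slope_ge g (- e) \<subseteq> slope r"
      using slope_local[of r] by blast
    have "P c e" if "c \<le> r" "r \<le> e" "e - c < d" for c e
      unfolding P_def using d(2)[OF that] local span_superset[of "slope r"]
      by (intro impI exI[of _ "{r}"]) auto
    then show ?case using d(1) by blast
  qed
  then show ?thesis by (simp add: P_def)
qed

lemma slope_ge_Int_trivial:
  assumes "s < r" "x \<in> slope_ge f r" "x \<in> slope_ge g (- s)"
  shows "x = 0"
proof -
  define e where "e = (r - s) / 3"
  have e: "e > 0" "3 * e = r - s" using assms(1) by (simp_all add: e_def)
  show ?thesis
    using assms e slope_ge_subset_decay[of "r - e" r f] slope_ge_subset_decay[of "- s - e" "- s" g]
    by (intro decay_Int_trivial[of "r - e" "- s - e"]) auto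
qed

lemma slope_independent:
  assumes "finite F" "\<And>r. r \<in> F \<Longrightarrow> y r \<in> slope r" "(\<Sum>r\<in>F. y r) = 0" "r \<in> F"
  shows "y r = 0"
proof -
  have "\<forall>r\<in>F. y r = 0"
    using assms(1-3)
  proof (induction F rule: finite_linorder_max_induct)
    case (insert b A)
    have "b \<notin> A" using insert.hyps by auto
    then have sum: "y b + (\<Sum>r\<in>A. y r) = 0" using insert by simp
    have "y b = 0"
    proof (cases "A = {}")
      case False
      define m where "m = Max A"
      have m: "m < b" using insert.hyps False by (simp add: m_def)
      have "(\<Sum>r\<in>A. y r) \<in> slope_ge g (- m)"
      proof (rule subspace_sum[OF subspace_slope_ge[OF lin_g]])
        fix r assume r: "r \<in> A"
        then have "- m \<le> - r" using insert.hyps by (simp add: m_def)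
        then show "y r \<in> slope_ge g (- m)"
          using insert.prems(1)[of r] r slope_ge_antimono[of "- m" "- r" g] by (auto simp: slope_def)
      qed
      then have "- (\<Sum>r\<in>A. y r) \<in> slope_ge g (- m)" by (rule subspace_neg[OF subspace_slope_ge[OF lin_g]])
      then have "y b \<in> slope_ge g (- m)" using sum by (metis eq_neg_iff_add_eq_0)
      moreover have "y b \<in> slope_ge f b" using insert.prems(1)[of b] by (auto simp: slope_def)
      ultimately show ?thesis using m slope_ge_Int_trivial by blast
    qed (use sum in simp)
    moreover have "\<forall>r\<in>A. y r = 0"
      using sum \<open>y b = 0\<close> insert.prems(1) by (intro insert.IH) auto
    ultimately show ?case by simp
  qed simp
  then show ?thesis using assms(4) by blast
qed

lemma span_Union_slope:
  assumes "finite F" "x \<in> span (\<Union>r\<in>F. slope r)"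
  shows "\<exists>y. (\<forall>r. y r \<in> slope r) \<and> x = (\<Sum>r\<in>F. y r)"
  using assms
proof (induction F arbitrary: x rule: finite_induct)
  case empty
  then show ?case using subspace_0[OF subspace_slope] by (intro exI[of _ "\<lambda>_. 0"]) auto
next
  case (insert a A)
  from insert.prems have "x \<in> span (slope a \<union> (\<Union>r\<in>A. slope r))" by simp
  then obtain u v where uv: "x = u + v" "u \<in> span (slope a)" "v \<in> span (\<Union>r\<in>A. slope r)"
    unfolding span_Un by blast
  have u: "u \<in> slope a" using uv(2) span_eq_iff[THEN iffD2, OF subspace_slope] by simp
  obtain y where y: "\<forall>r. y r \<in> slope r" "v = (\<Sum>r\<in>A. y r)" using insert.IH[OF uv(3)] by blast
  have "(\<Sum>r\<in>insert a A. (y(a := u)) r) = u + (\<Sum>r\<in>A. y r)"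
    using insert.hyps by (simp, intro sum.cong) auto
  then show ?case using u y uv(1) by (intro exI[of _ "y(a := u)"]) auto
qed

lemma slope_eq_0:
  assumes F: "finite F" "\<And>x. \<exists>y. (\<forall>r. y r \<in> slope r) \<and> x = (\<Sum>r\<in>F. y r)"
    and r: "r \<notin> F"
  shows "slope r = {0}"
proof -
  have "x = 0" if x: "x \<in> slope r" for x
  proof -
    obtain y where y: "\<forall>r. y r \<in> slope r" "x = (\<Sum>r\<in>F. y r)" using F(2) by blast
    have "(\<Sum>s\<in>insert r F. (y(r := - x)) s) = - x + (\<Sum>s\<in>F. y s)"
      using F(1) r by (simp, intro sum.cong) auto
    then have "(\<Sum>s\<in>insert r F. (y(r := - x)) s) = 0" using y(2) by simp
    moreover have "(y(r := - x)) s \<in> slope s" for s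
      using y(1) subspace_neg[OF subspace_slope x] by simp
    ultimately have "(y(r := - x)) r = 0"
      using F(1) slope_independent[of "insert r F" "y(r := - x)" r] by blast
    then show ?thesis by simp
  qed
  then show ?thesis using subspace_0[OF subspace_slope] by blast
qed

text \<open>If the iterates of the basis vectors tend to \<open>0\<close>, then some power \<open>f\<^sup>e\<close> maps \<open>Lat 0\<close> into \<open>Lat 1\<close>,
and all rates are at least \<open>1/e\<close>. Boundedness of \<open>g\<close> gives an upper bound for the rates.\<close>

lemma contraction_slope_span:
  assumes contr: "\<And>b k. b \<in> B \<Longrightarrow> eventually (\<lambda>n. (f ^^ n) b \<in> Lat k) sequentially"
  obtains F where "finite F" "F \<subseteq> {0<..}" "\<And>x. \<exists>y. (\<forall>r. y r \<in> slope r) \<and> x = (\<Sum>r\<in>F. y r)"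
proof -
  have "eventually (\<lambda>n. \<forall>b\<in>B. (f ^^ n) b \<in> Lat 1) sequentially"
    using contr by (intro eventually_ball_finite finite_Basis) auto
  then have "eventually (\<lambda>n. n > 0 \<and> (\<forall>b\<in>B. (f ^^ n) b \<in> Lat 1)) sequentially"
    using eventually_gt_at_top by (rule eventually_conj[rotated])
  then obtain e where e: "e > 0" "\<And>b. b \<in> B \<Longrightarrow> (f ^^ e) b \<in> Lat 1"
    using eventually_happens by (metis (mono_tags, lifting) sequentially_bot)
  have fe: "(f ^^ e) x \<in> Lat (k + 1)" if "x \<in> Lat k" for x k
  proof -
    interpret fe: Vector_Spaces.linear smul smul "f ^^ e" using lin_funpow[OF lin_f] .
    have "(f ^^ e) x = (\<Sum>b\<in>B. smul (representation B x b) ((f ^^ e) b))"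
      using arg_cong[OF sum_rep[of x], of "f ^^ e"] by (simp add: fe.sum fe.scale)
    also have "\<dots> \<in> Lat (k + 1)"
      using that e(2) by (intro Lat_sum Lat_scale) (auto simp: Lat_def)
    finally show ?thesis .
  qed
  have f_all: "x \<in> slope_ge f (1 / real e)" for x
  proof -
    obtain k where k: "x \<in> Lat k" using ex_Lat by blast
    have "(f ^^ (e * n)) x \<in> Lat (k + 1 * int n)" for n
    proof (induction n)
      case (Suc n)
      have "(f ^^ (e * Suc n)) x = (f ^^ e) ((f ^^ (e * n)) x)" by (simp add: funpow_add)
      then show ?case using fe[OF Suc] by (simp add: algebra_simps)
    qed (use k in simp)
    then have "x \<in> decay f (of_int 1 / real e)" by (rule decay_from_power[OF lin_f e(1)])
    then show ?thesis using decay_subset_slope_ge[of "1 / real e" "1 / real e" f] by auto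
  qed
  obtain c where c: "\<And>k x. x \<in> Lat k \<Longrightarrow> g x \<in> Lat (k + c)"
    using linear_bounded[OF lin_g] by blast
  define b where "b = max (1 / real e) (- of_int c)"
  have g_all: "x \<in> slope_ge g (- b)" for x
  proof -
    obtain k where k: "x \<in> Lat k" using ex_Lat by blast
    have "(g ^^ (1 * n)) x \<in> Lat (k + c * int n)" for n
    proof (induction n)
      case (Suc n)
      then show ?case using c[OF Suc] by (simp add: algebra_simps)
    qed (use k in simp)
    then have "x \<in> decay g (of_int c / real 1)" by (intro decay_from_power[OF lin_g]) auto
    moreover have "- b \<le> of_int c" by (simp add: b_def)
    ultimately show ?thesis using decay_subset_slope_ge[of "- b" "of_int c" g] by auto
  qed
  obtain F where F: "finite F" "F \<subseteq> {1 / real e..b}"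
    "slope_ge f (1 / real e) \<inter> slope_ge g (- b) \<subseteq> span (\<Union>r\<in>F. slope r)"
    using slope_span[of "1 / real e" b] by (auto simp: b_def)
  show ?thesis
  proof (rule that[OF F(1)])
    have "{1 / real e..b} \<subseteq> {0<..}" using e(1) by (auto intro: less_le_trans[of 0 "1 / real e"])
    then show "F \<subseteq> {0<..}" using F(2) by (rule subset_trans[rotated])
    show "\<exists>y. (\<forall>r. y r \<in> slope r) \<and> x = (\<Sum>r\<in>F. y r)" for x
      using F(3) f_all g_all by (intro span_Union_slope[OF F(1)]) blast
  qed
qed

end

section \<open>From real to natural degrees\<close>

text \<open>Let \<open>q\<close> be a positive integer such that each \<open>q r\<close> with \<open>r \<in> F\<close> has distance less than \<open>e\<close> from an
integer \<open>k r\<close>. Here \<open>e \<le> 1/4\<close> forces additivity of \<open>k\<close>, \<open>e \<le> r\<close> forces positivity, and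
\<open>2 e \<le> \<bar>r - s\<bar>\<close> forces injectivity.\<close>

lemma ex_additive_rounding:
  fixes F :: "real set"
  assumes F: "finite F" "F \<subseteq> {0<..}"
  obtains h :: "real \<Rightarrow> nat" where "\<And>r. r \<in> F \<Longrightarrow> h r > 0" "inj_on h F"
    "\<And>r s. r \<in> F \<Longrightarrow> s \<in> F \<Longrightarrow> r + s \<in> F \<Longrightarrow> h (r + s) = h r + h s"
proof -
  define A where "A = {1 / 4} \<union> F \<union> (\<lambda>(r, s). \<bar>r - s\<bar> / 2) ` {(r, s) \<in> F \<times> F. r \<noteq> s}"
  have finA: "finite A" unfolding A_def
    by (intro finite_UnI finite_imageI F(1) finite_subset[OF _ finite_cartesian_product[OF F(1) F(1)]]) auto
  have posA: "\<forall>a\<in>A. a > 0" using F(2) by (auto simp: A_def)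
  define e where "e = Min A"
  have "A \<noteq> {}" by (auto simp: A_def)
  then have e: "e > 0" "\<And>a. a \<in> A \<Longrightarrow> e \<le> a" using finA posA by (auto simp: e_def)
  have e4: "e \<le> 1 / 4" by (rule e(2)) (auto simp: A_def)
  have eF: "e \<le> r" if "r \<in> F" for r using that by (intro e(2)) (auto simp: A_def)
  have e_diff: "2 * e \<le> \<bar>r - s\<bar>" if "r \<in> F" "s \<in> F" "r \<noteq> s" for r s
  proof -
    have "\<bar>r - s\<bar> / 2 \<in> A" using that by (force simp: A_def)
    then show ?thesis using e(2) by fastforce
  qed
  obtain M :: nat where M: "M > 0" "1 / M < e" using e(1) by (metis nat_approx_posE zero_less_Suc)
  obtain \<theta> :: "nat \<Rightarrow> real" where \<theta>: "bij_betw \<theta> {0..<card F} F"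
    using ex_bij_betw_nat_finite[OF F(1)] by blast
  obtain q p where q: "0 < q" and p: "\<And>i. i < card F \<Longrightarrow> \<bar>of_int q * \<theta> i - of_int (p i)\<bar> < 1 / M"
    using Dirichlet_approx_simult[OF M(1), of "card F" \<theta>] by metis
  define k where "k r = p (inv_into {0..<card F} \<theta> r)" for r
  have k: "\<bar>of_int q * r - of_int (k r)\<bar> < e" if "r \<in> F" for r
  proof -
    have "inv_into {0..<card F} \<theta> r < card F" "\<theta> (inv_into {0..<card F} \<theta> r) = r"
      using \<theta> that inv_into_into[of r \<theta> "{0..<card F}"] f_inv_into_f[of r \<theta> "{0..<card F}"]
      by (auto simp: bij_betw_def)
    then show ?thesis using p[of "inv_into {0..<card F} \<theta> r"] M(2) by (simp add: k_def)
  qed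
  have q1: "of_int q \<ge> (1::real)" using q by simp
  have k_pos: "k r > 0" if r: "r \<in> F" for r
  proof -
    have "r \<le> of_int q * r" using q1 F(2) r by (auto simp: mult_le_cancel_right1)
    then have "real_of_int (k r) > 0" using k[OF r] eF[OF r] by linarith
    then show ?thesis by simp
  qed
  show ?thesis
  proof (rule that[of "\<lambda>r. nat (k r)"])
    show "nat (k r) > 0" if "r \<in> F" for r using k_pos[OF that] by simp
    show "inj_on (\<lambda>r. nat (k r)) F"
    proof (rule inj_onI, rule ccontr)
      fix r s assume rs: "r \<in> F" "s \<in> F" "nat (k r) = nat (k s)" "r \<noteq> s"
      then have "k r = k s" using k_pos by (simp add: eq_nat_nat_iff less_imp_le)
      then have close: "\<bar>of_int q * r - of_int q * s\<bar> < 2 * e"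
        using k[OF rs(1)] k[OF rs(2)] by linarith
      have "2 * e \<le> 1 * \<bar>r - s\<bar>" using e_diff[OF rs(1,2,4)] by simp
      also have "\<dots> \<le> of_int q * \<bar>r - s\<bar>" using q1 by (intro mult_right_mono) auto
      also have "\<dots> = \<bar>of_int q * r - of_int q * s\<bar>"
        using q by (simp add: abs_mult flip: right_diff_distrib)
      finally show False using close by simp
    qed
    fix r s assume rs: "r \<in> F" "s \<in> F" "r + s \<in> F"
    have "of_int q * (r + s) = of_int q * r + of_int q * s" by (rule distrib_left)
    then have "\<bar>real_of_int (k (r + s) - k r - k s)\<bar> < 1"
      using k[OF rs(1)] k[OF rs(2)] k[OF rs(3)] e4 by simp
    then have "k (r + s) = k r + k s" by linarith
    then show "nat (k (r + s)) = nat (k r) + nat (k s)"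
      using k_pos rs by (simp add: nat_add_distrib less_imp_le)
  qed
qed

context lie_algebra begin

lemma direct_sum_decompositionI:
  assumes J: "finite J" "J \<subseteq> I" and sub: "\<And>i. i \<in> I \<Longrightarrow> subspace (V i)"
    and triv: "\<And>i. i \<in> I \<Longrightarrow> i \<notin> J \<Longrightarrow> V i = {0}"
    and span: "\<And>x. \<exists>y. (\<forall>i\<in>J. y i \<in> V i) \<and> x = (\<Sum>i\<in>J. y i)"
    and indep: "\<And>y i. (\<And>j. j \<in> J \<Longrightarrow> y j \<in> V j) \<Longrightarrow> (\<Sum>j\<in>J. y j) = 0 \<Longrightarrow> i \<in> J \<Longrightarrow> y i = 0"
  shows "direct_sum_decomposition I V"
  unfolding direct_sum_decomposition_def
proof (intro conjI ballI allI)
  fix x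
  define P where "P f \<longleftrightarrow> (\<forall>i\<in>I. f i \<in> V i) \<and> (\<forall>i. i \<notin> I \<longrightarrow> f i = 0) \<and>
        finite {i. f i \<noteq> 0} \<and> x = (\<Sum>i | f i \<noteq> 0. f i)" for f
  have P: "(\<forall>i\<in>J. f i \<in> V i) \<and> (\<forall>i. i \<notin> J \<longrightarrow> f i = 0) \<and> x = (\<Sum>i\<in>J. f i)" if "P f" for f
  proof -
    have f0: "f i = 0" if "i \<notin> J" for i
      using that \<open>P f\<close> triv[of i] by (cases "i \<in> I") (auto simp: P_def)
    then have "(\<Sum>i\<in>J. f i) = (\<Sum>i | f i \<noteq> 0. f i)"
      by (intro sum.mono_neutral_right J) auto
    then show ?thesis using \<open>P f\<close> f0 J(2) by (auto simp: P_def)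
  qed
  obtain y where y: "\<forall>i\<in>J. y i \<in> V i" "x = (\<Sum>i\<in>J. y i)" using span by blast
  define f where "f i = (if i \<in> J then y i else 0)" for i
  have "P f"
    unfolding P_def
  proof (intro conjI ballI allI impI)
    show "f i \<in> V i" if "i \<in> I" for i using y(1) subspace_0[OF sub[OF that]] by (simp add: f_def)
    show "f i = 0" if "i \<notin> I" for i using that J(2) by (auto simp: f_def)
    show "finite {i. f i \<noteq> 0}" by (rule finite_subset[OF _ J(1)]) (auto simp: f_def)
    have "x = (\<Sum>i\<in>J. f i)" unfolding y(2) by (intro sum.cong) (auto simp: f_def)
    also have "\<dots> = (\<Sum>i | f i \<noteq> 0. f i)"
      by (intro sum.mono_neutral_right J) (auto simp: f_def)
    finally show "x = (\<Sum>i | f i \<noteq> 0. f i)" .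
  qed
  moreover have "f' = f" if f': "P f'" for f'
  proof
    fix i
    show "f' i = f i"
    proof (cases "i \<in> J")
      case True
      have "f' j - f j \<in> V j" if "j \<in> J" for j
        using P[OF f'] P[OF \<open>P f\<close>] that J(2) by (intro subspace_diff sub) auto
      moreover have "(\<Sum>j\<in>J. f' j - f j) = 0"
        using P[OF f'] P[OF \<open>P f\<close>] by (simp add: sum_subtractf)
      ultimately have "f' i - f i = 0" using indep[of "\<lambda>j. f' j - f j" i] True by blast
      then show ?thesis by simp
    qed (use P[OF f'] P[OF \<open>P f\<close>] in auto)
  qed
  ultimately show "\<exists>!f. (\<forall>i\<in>I. f i \<in> V i) \<and> (\<forall>i. i \<notin> I \<longrightarrow> f i = 0) \<and>
        finite {i. f i \<noteq> 0} \<and> x = (\<Sum>i | f i \<noteq> 0. f i)"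
    unfolding P_def[symmetric] by blast
qed (rule sub)

text \<open>A gradation with real degrees can be regraded by natural numbers.\<close>

lemma nat_gradation_of_real_slopes:
  fixes S :: "real \<Rightarrow> 'g set"
  assumes F: "finite F" "F \<subseteq> {0<..}" and sub: "\<And>r. subspace (S r)"
    and triv: "\<And>r. r \<notin> F \<Longrightarrow> S r = {0}"
    and span: "\<And>x. \<exists>y. (\<forall>r. y r \<in> S r) \<and> x = (\<Sum>r\<in>F. y r)"
    and indep: "\<And>y r. (\<And>r. r \<in> F \<Longrightarrow> y r \<in> S r) \<Longrightarrow> (\<Sum>r\<in>F. y r) = 0 \<Longrightarrow> r \<in> F \<Longrightarrow> y r = 0"
    and bracket: "\<And>r s x y. x \<in> S r \<Longrightarrow> y \<in> S s \<Longrightarrow> bracket x y \<in> S (r + s)"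
  shows "\<exists>G. nat_gradation G"
proof -
  obtain h :: "real \<Rightarrow> nat" where h: "\<And>r. r \<in> F \<Longrightarrow> h r > 0" "inj_on h F"
    "\<And>r s. r \<in> F \<Longrightarrow> s \<in> F \<Longrightarrow> r + s \<in> F \<Longrightarrow> h (r + s) = h r + h s"
    using ex_additive_rounding[OF F] by blast
  define H where "H r = real (h r)" for r
  have inj: "inj_on H F" using h(2) by (auto simp: H_def inj_on_def)
  define G where "G t = (if t \<in> H ` F then S (inv_into F H t) else {0})" for t
  have G_H: "G (H r) = S r" if "r \<in> F" for r using that inj by (simp add: G_def)
  have G_0: "G t = {0}" if "t \<notin> H ` F" for t using that by (simp add: G_def)
  have subG: "subspace (G t)" for t
    using sub subspace_single_0 by (simp add: G_def)
  have "direct_sum_decomposition {0<..} G"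
  proof (rule direct_sum_decompositionI)
    show "finite (H ` F)" using F(1) by simp
    show "H ` F \<subseteq> {0<..}" using h(1) by (auto simp: H_def)
    fix x
    obtain y where y: "\<forall>r. y r \<in> S r" "x = (\<Sum>r\<in>F. y r)" using span by blast
    have "x = (\<Sum>t\<in>H ` F. y (inv_into F H t))"
      unfolding y(2) by (subst sum.reindex[OF inj]) (auto intro!: sum.cong simp: inj)
    moreover have "\<forall>t\<in>H ` F. y (inv_into F H t) \<in> G t" using y(1) by (simp add: G_def)
    ultimately show "\<exists>y. (\<forall>t\<in>H ` F. y t \<in> G t) \<and> x = (\<Sum>t\<in>H ` F. y t)"
      by (intro exI[of _ "\<lambda>t. y (inv_into F H t)"]) blast
  next
    fix y t assume y: "\<And>t. t \<in> H ` F \<Longrightarrow> y t \<in> G t" "(\<Sum>t\<in>H ` F. y t) = 0" and t: "t \<in> H ` F"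
    obtain r where r: "r \<in> F" "t = H r" using t by blast
    have "(\<Sum>r\<in>F. y (H r)) = 0" using y(2) by (simp add: sum.reindex[OF inj])
    moreover have "y (H r) \<in> S r" if "r \<in> F" for r using y(1)[of "H r"] that G_H by auto
    ultimately show "y t = 0" using indep[of "\<lambda>r. y (H r)" r] r by blast
  qed (simp_all add: subG G_0)
  moreover have "finite {t. t > 0 \<and> G t \<noteq> {0}}"
    by (rule finite_subset[of _ "H ` F"]) (use F(1) G_0 in auto)
  moreover have "bracket x y \<in> G (t + u)" if xy: "x \<in> G t" "y \<in> G u" for t u x y
  proof (cases "t \<in> H ` F \<and> u \<in> H ` F")
    case True
    then obtain r s where rs: "r \<in> F" "t = H r" "s \<in> F" "u = H s" by blast
    have mem: "bracket x y \<in> S (r + s)" using xy rs by (intro bracket) (simp_all add: G_H)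
    show ?thesis
    proof (cases "r + s \<in> F")
      case True
      then have "H (r + s) = t + u" using h(3) rs by (simp add: H_def)
      then show ?thesis using mem G_H[OF True] by simp
    next
      case False
      then show ?thesis using mem triv subspace_0[OF subG] by auto
    qed
  next
    case False
    interpret l: Vector_Spaces.linear smul smul "\<lambda>x. bracket x y" by (rule linear_bracket_left)
    interpret r: Vector_Spaces.linear smul smul "bracket x" by (rule linear_bracket_right)
    have "x = 0 \<or> y = 0" using False xy G_0 by auto
    then have "bracket x y = 0" using l.zero r.zero by auto
    then show ?thesis using subspace_0[OF subG] by simp
  qed
  moreover have "t \<in> \<nat>" if "G t \<noteq> {0}" for t
  proof -
    have "t \<in> H ` F" using that G_0 by blast
    then show ?thesis by (auto simp: H_def)
  qed
  ultimately show ?thesis unfolding nat_gradation_def positive_gradation_def by blast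
qed

end

section \<open>Scaling automorphisms of graded Lie algebras\<close>

text \<open>A Lie algebra, over an arbitrary field, with a fixed \<open>\<nat>\<close>-gradation \<open>G\<close>.\<close>

locale nat_graded_lie_algebra = lie_algebra smul bracket
  for smul :: "'k::field \<Rightarrow> 'g::ab_group_add \<Rightarrow> 'g" and bracket +
  fixes G :: "real \<Rightarrow> 'g set"
  assumes nat_gradation: "nat_gradation G"
begin

text \<open>The finite set of degrees that occur.\<close>

definition J :: "real set" where "J = {r. r > 0 \<and> G r \<noteq> {0}}"

text \<open>The degree as a natural number, for use as an exponent.\<close>

definition degree :: "real \<Rightarrow> nat" where "degree r = nat \<lfloor>r\<rfloor>"

lemma finite_J: "finite J"
  using nat_gradation unfolding nat_gradation_def positive_gradation_def J_def by blast

lemma subspace_G: "r > 0 \<Longrightarrow> subspace (G r)"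
  using nat_gradation
  unfolding nat_gradation_def positive_gradation_def direct_sum_decomposition_def by blast

lemma bracket_G: "r > 0 \<Longrightarrow> s > 0 \<Longrightarrow> x \<in> G r \<Longrightarrow> y \<in> G s \<Longrightarrow> bracket x y \<in> G (r + s)"
  using nat_gradation unfolding nat_gradation_def positive_gradation_def by blast

lemma J_pos: "r \<in> J \<Longrightarrow> r > 0" by (simp add: J_def)

lemma real_degree: assumes "r \<in> J" shows "real (degree r) = r"
proof -
  have "r \<in> \<nat>" using assms nat_gradation unfolding nat_gradation_def J_def by blast
  then show ?thesis by (auto simp: degree_def Nats_def)
qed

lemma degree_pos: "r \<in> J \<Longrightarrow> degree r > 0"
  using real_degree[of r] J_pos[of r] by (metis of_nat_0_less_iff)

lemma degree_add: assumes "r \<in> J" "s \<in> J" shows "degree (r + s) = degree r + degree s"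
proof -
  have "r + s = real (degree r + degree s)" using assms by (simp add: real_degree)
  then have "degree (r + s) = nat \<lfloor>real (degree r + degree s)\<rfloor>" by (simp only: degree_def)
  then show ?thesis by (simp only: floor_of_nat nat_int)
qed

lemma ex1_components:
  "\<exists>!f. (\<forall>r\<in>J. f r \<in> G r) \<and> (\<forall>r. r \<notin> J \<longrightarrow> f r = 0) \<and> x = (\<Sum>r\<in>J. f r)"
proof -
  define P where "P f \<longleftrightarrow> (\<forall>r\<in>J. f r \<in> G r) \<and> (\<forall>r. r \<notin> J \<longrightarrow> f r = 0) \<and> x = (\<Sum>r\<in>J. f r)" for f
  define Q where "Q f \<longleftrightarrow> (\<forall>i\<in>{0<..}. f i \<in> G i) \<and> (\<forall>i. i \<notin> {0<..} \<longrightarrow> f i = 0) \<and>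
        finite {i. f i \<noteq> 0} \<and> x = (\<Sum>i | f i \<noteq> 0. f i)" for f
  have sum: "(\<Sum>r | f r \<noteq> 0. f r) = (\<Sum>r\<in>J. f r)" if "\<forall>r. r \<notin> J \<longrightarrow> f r = 0" for f :: "real \<Rightarrow> 'g"
    using that by (intro sum.mono_neutral_left finite_J) auto
  have "Q f = P f" for f
  proof
    assume Q: "Q f"
    have "\<forall>r. r \<notin> J \<longrightarrow> f r = 0" using Q by (auto simp: Q_def J_def)
    moreover have "x = (\<Sum>r\<in>J. f r)" using Q sum[OF calculation] unfolding Q_def by simp
    ultimately show "P f" using Q J_pos unfolding P_def Q_def by blast
  next
    assume P: "P f"
    have "finite {r. f r \<noteq> 0}"
      by (rule finite_subset[OF _ finite_J]) (use P in \<open>auto simp: P_def\<close>)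
    moreover have "f r \<in> G r" if "r > 0" for r
      using P subspace_0[OF subspace_G[OF that]] by (cases "r \<in> J") (auto simp: P_def)
    moreover have "f r = 0" if "\<not> r > 0" for r using P that J_pos by (auto simp: P_def)
    moreover have "x = (\<Sum>r | f r \<noteq> 0. f r)" using P sum[of f] unfolding P_def by simp
    ultimately show "Q f" unfolding Q_def by blast
  qed
  then have "Q = P" by blast
  have "direct_sum_decomposition {0<..} G"
    using nat_gradation unfolding nat_gradation_def positive_gradation_def by blast
  then have "\<exists>!f. Q f" unfolding Q_def direct_sum_decomposition_def by (elim conjE) (rule spec)
  then show ?thesis unfolding \<open>Q = P\<close> unfolding P_def .
qed

text \<open>The family of the homogeneous components of \<open>x\<close>; it vanishes outside \<open>J\<close>.\<close>

definition component :: "'g \<Rightarrow> real \<Rightarrow> 'g" where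
  "component x = (THE f. (\<forall>r\<in>J. f r \<in> G r) \<and> (\<forall>r. r \<notin> J \<longrightarrow> f r = 0) \<and> x = (\<Sum>r\<in>J. f r))"

lemma component: "r \<in> J \<Longrightarrow> component x r \<in> G r" "r \<notin> J \<Longrightarrow> component x r = 0"
    "(\<Sum>r\<in>J. component x r) = x"
  using theI'[OF ex1_components[of x]] unfolding component_def[symmetric] by auto

lemma component_eqI:
  assumes "\<And>r. r \<in> J \<Longrightarrow> y r \<in> G r" "x = (\<Sum>r\<in>J. y r)" "r \<in> J"
  shows "component x r = y r"
proof -
  define y' where "y' r = (if r \<in> J then y r else 0)" for r
  have "(\<forall>r\<in>J. y' r \<in> G r) \<and> (\<forall>r. r \<notin> J \<longrightarrow> y' r = 0) \<and> x = (\<Sum>r\<in>J. y' r)"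
    using assms by (auto simp: y'_def)
  then have "component x = y'"
    unfolding component_def by (rule the1_equality[OF ex1_components])
  then show ?thesis using assms(3) by (simp add: y'_def)
qed

text \<open>Multiplication by \<open>c\<^sup>r\<close> on the component of degree \<open>r\<close>.\<close>

definition grade_scale :: "'k \<Rightarrow> 'g \<Rightarrow> 'g" where
  "grade_scale c x = (\<Sum>r\<in>J. smul (c ^ degree r) (component x r))"

lemma component_grade_scale:
  assumes "r \<in> J" shows "component (grade_scale c x) r = smul (c ^ degree r) (component x r)"
  using assms by (intro component_eqI)
    (auto simp: grade_scale_def intro!: subspace_scale subspace_G J_pos component)

lemma grade_scale_grade_scale: "grade_scale c (grade_scale d x) = grade_scale (c * d) x"
  unfolding grade_scale_def[of c] grade_scale_def[of "c * d"]
  by (intro sum.cong) (simp_all add: component_grade_scale power_mult_distrib)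

lemma grade_scale_1: "grade_scale 1 x = x"
  by (simp add: grade_scale_def component)

lemma funpow_grade_scale: "(grade_scale c ^^ n) x = grade_scale (c ^ n) x"
  by (induction n) (simp_all add: grade_scale_1 grade_scale_grade_scale)

lemma linear_grade_scale: "Vector_Spaces.linear smul smul (grade_scale c)"
proof -
  have add: "component (x + y) r = component x r + component y r" if "r \<in> J" for x y r
    using that by (intro component_eqI[of "\<lambda>r. component x r + component y r"])
      (auto simp: sum.distrib component intro!: subspace_add subspace_G J_pos)
  have scale: "component (smul a x) r = smul a (component x r)" if "r \<in> J" for a x r
    using that by (intro component_eqI[of "\<lambda>r. smul a (component x r)"])
      (auto simp: component simp flip: scale_sum_right intro!: subspace_scale subspace_G J_pos)
  show ?thesis
    unfolding Vector_Spaces.linear_iff using vector_space_axioms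
    by (auto simp: grade_scale_def add scale scale_right_distrib sum.distrib scale_sum_right
        mult.commute intro!: sum.cong)
qed

lemma grade_scale_homogeneous:
  assumes "r > 0" "z \<in> G r"
  shows "grade_scale c z = smul (c ^ degree r) z"
proof (cases "r \<in> J")
  case True
  have comp: "component z s = (if s = r then z else 0)" if "s \<in> J" for s
    using that True assms finite_J subspace_0[OF subspace_G[OF J_pos]]
    by (intro component_eqI[of "\<lambda>s. if s = r then z else 0"]) auto
  have "grade_scale c z = (\<Sum>s\<in>J. if s = r then smul (c ^ degree r) z else 0)"
    unfolding grade_scale_def by (intro sum.cong) (auto simp: comp)
  then show ?thesis using True finite_J by simp
next
  case False
  then have "z = 0" using assms by (auto simp: J_def)
  interpret l: Vector_Spaces.linear smul smul "grade_scale c" by (rule linear_grade_scale)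
  show ?thesis using \<open>z = 0\<close> l.zero by simp
qed

lemma grade_scale_bracket: "grade_scale c (bracket x y) = bracket (grade_scale c x) (grade_scale c y)"
proof -
  interpret l: Vector_Spaces.linear smul smul "grade_scale c" by (rule linear_grade_scale)
  interpret bl: Vector_Spaces.linear smul smul "\<lambda>u. bracket u v" for v by (rule linear_bracket_left)
  interpret br: Vector_Spaces.linear smul smul "bracket u" for u by (rule linear_bracket_right)
  have expand: "bracket (\<Sum>r\<in>J. u r) (\<Sum>s\<in>J. v s) = (\<Sum>r\<in>J. \<Sum>s\<in>J. bracket (u r) (v s))" for u v
    by (subst bl.sum) (simp add: br.sum)
  have "bracket x y = (\<Sum>r\<in>J. \<Sum>s\<in>J. bracket (component x r) (component y s))"
    using expand[of "component x" "component y"] by (simp add: component)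
  then have "grade_scale c (bracket x y) =
      (\<Sum>r\<in>J. \<Sum>s\<in>J. grade_scale c (bracket (component x r) (component y s)))"
    by (simp add: l.sum)
  also have "\<dots> = (\<Sum>r\<in>J. \<Sum>s\<in>J. bracket (smul (c ^ degree r) (component x r)) (smul (c ^ degree s) (component y s)))"
  proof (intro sum.cong refl)
    fix r s assume rs: "r \<in> J" "s \<in> J"
    have "bracket (component x r) (component y s) \<in> G (r + s)"
      using rs by (intro bracket_G J_pos component)
    then have "grade_scale c (bracket (component x r) (component y s)) =
        smul (c ^ degree (r + s)) (bracket (component x r) (component y s))"
      using rs J_pos by (intro grade_scale_homogeneous add_pos_pos)
    then show "grade_scale c (bracket (component x r) (component y s)) =
        bracket (smul (c ^ degree r) (component x r)) (smul (c ^ degree s) (component y s))"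
      by (simp add: bl.scale br.scale degree_add[OF rs] power_add)
  qed
  also have "\<dots> = bracket (grade_scale c x) (grade_scale c y)"
    unfolding grade_scale_def by (rule expand[symmetric])
  finally show ?thesis .
qed

lemma automorphism_grade_scale:
  assumes "c \<noteq> 0" shows "automorphism (grade_scale c)"
proof -
  have "bij (grade_scale c)"
    using assms by (intro o_bij[of "grade_scale (inverse c)"])
      (auto simp: o_def grade_scale_grade_scale grade_scale_1 id_def)
  then show ?thesis
    by (simp add: automorphism_def linear_grade_scale grade_scale_bracket)
qed

end

section \<open>Contractibility and gradations\<close>

theorem proposition3p1:
  fixes smul :: "'k::local_field \<Rightarrow> 'g::ab_group_add \<Rightarrow> 'g"
    and bracket :: "'g \<Rightarrow> 'g \<Rightarrow> 'g"
  assumes "finite_dimensional_lie_algebra smul bracket"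
  shows "contractible_lie_algebra smul bracket \<longleftrightarrow>
    (\<exists>G. lie_algebra.nat_gradation smul bracket G)"
proof -
  interpret finite_dimensional_lie_algebra smul bracket by fact
  obtain R :: "'k set" and p where Rp: "contracting_scale R p"
    using ex_contracting_scale by blast
  obtain B where B: "is_basis smul B" using ex_basis[OF vector_space_axioms] by blast
  have "finite_dimensional_vector_space smul B"
    using B finite_basis[OF vector_space_axioms finite_dimensional B]
    by unfold_locales (auto simp: is_basis_def)
  then interpret S: scaled_space smul B R p
    using Rp by (rule scaled_space.intro)
  show ?thesis
  proof
    assume "contractible_lie_algebra smul bracket"
    then obtain f where f: "automorphism f" "contractive smul f"
      unfolding contractible_lie_algebra_def by blast
    have lin_f: "Vector_Spaces.linear smul smul f" and "bij f"
      and f_br: "\<And>x y. f (bracket x y) = bracket (f x) (f y)"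
      using f(1) by (auto simp: automorphism_def)
    define g where "g = inv f"
    have fg: "f (g x) = x" and gf: "g (f x) = x" for x
      using \<open>bij f\<close> by (simp_all add: g_def bij_is_surj surj_f_inv_f bij_is_inj)
    interpret lf: Vector_Spaces.linear smul smul f by fact
    have g_eqI: "g x = y" if "x = f y" for x y using that gf by simp
    have lin_g: "Vector_Spaces.linear smul smul g"
      unfolding Vector_Spaces.linear_iff using vector_space_axioms
      by (auto intro!: g_eqI simp: lf.add lf.scale fg)
    have g_br: "g (bracket x y) = bracket (g x) (g y)" for x y
      by (rule g_eqI) (simp add: f_br fg)
    interpret A: scaled_automorphism smul B R p f g
      by (intro scaled_automorphism.intro scaled_automorphism_axioms.intro
        S.scaled_space_axioms lin_f lin_g fg gf)
    have "eventually (\<lambda>n. (f ^^ n) x \<in> S.Lat k) sequentially" for x k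
      using f(2) unfolding contractive_def S.limitin_canonical_topology_0_iff by blast
    then obtain F where F: "finite F" "F \<subseteq> {0<..}"
      "\<And>x. \<exists>y. (\<forall>r. y r \<in> A.slope r) \<and> x = (\<Sum>r\<in>F. y r)"
      by (rule A.contraction_slope_span) blast
    have bracket_slope: "bracket x y \<in> A.slope (r + s)"
      if xy: "x \<in> A.slope r" "y \<in> A.slope s" for x y r s
    proof -
      have x: "x \<in> S.slope_ge f r" "x \<in> S.slope_ge g (- r)"
        and y: "y \<in> S.slope_ge f s" "y \<in> S.slope_ge g (- s)"
        using xy by (simp_all add: A.slope_def)
      have "bracket x y \<in> S.slope_ge f (r + s)"
        by (rule S.slope_ge_bilinear[OF linear_bracket_left linear_bracket_right f_br x(1) y(1)])
      moreover have "bracket x y \<in> S.slope_ge g (- r + - s)"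
        by (rule S.slope_ge_bilinear[OF linear_bracket_left linear_bracket_right g_br x(2) y(2)])
      ultimately show ?thesis by (simp add: A.slope_def)
    qed
    show "\<exists>G. nat_gradation G"
    proof (rule nat_gradation_of_real_slopes[of F A.slope])
      show "\<exists>y. (\<forall>r. y r \<in> A.slope r) \<and> x = (\<Sum>r\<in>F. y r)" for x by (rule F(3))
      show "A.slope r = {0}" if "r \<notin> F" for r using F(1,3) that by (rule A.slope_eq_0)
      fix y r
      assume "\<And>r. r \<in> F \<Longrightarrow> y r \<in> A.slope r" "(\<Sum>r\<in>F. y r) = 0" "r \<in> F"
      then show "y r = 0" by (rule A.slope_independent[OF F(1)])
    qed (fact F(1) F(2) A.subspace_slope bracket_slope)+
  next
    assume "\<exists>G. nat_gradation G"
    then obtain G where "nat_gradation G" by blast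
    then interpret N: nat_graded_lie_algebra smul bracket G by unfold_locales
    have "eventually (\<lambda>n. (N.grade_scale p ^^ n) x \<in> S.Lat k) sequentially" for x k
    proof -
      obtain j where j: "\<forall>y\<in>N.component x ` N.J. y \<in> S.Lat j"
        using S.ex_Lat_finite[OF finite_imageI[OF N.finite_J]] by blast
      have "(N.grade_scale p ^^ n) x \<in> S.Lat k" if n: "n \<ge> nat (k - j)" for n
        unfolding N.funpow_grade_scale N.grade_scale_def
      proof (rule S.Lat_sum)
        fix r assume r: "r \<in> N.J"
        have "n * 1 \<le> n * N.degree r" using N.degree_pos[OF r] by (intro mult_le_mono2) simp
        then have "k - int (n * N.degree r) \<le> j" using n by linarith
        then have "N.component x r \<in> S.Lat (k - int (n * N.degree r))"
          using j r S.Lat_antimono by blast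
        then have "smul (p powi int (n * N.degree r)) (N.component x r) \<in> S.Lat k"
          by (simp only: S.Lat_powi)
        then show "smul ((p ^ n) ^ N.degree r) (N.component x r) \<in> S.Lat k"
          by (simp add: power_int_of_nat power_mult del: of_nat_mult)
      qed
      then show ?thesis unfolding eventually_sequentially by blast
    qed
    then have "contractive smul (N.grade_scale p)"
      unfolding contractive_def S.limitin_canonical_topology_0_iff by blast
    then show "contractible_lie_algebra smul bracket"
      unfolding contractible_lie_algebra_def
      using N.automorphism_grade_scale[OF S.p_nonzero] by blast
  qed
qed

end
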